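(* (i) For every sequence $\mathbf{s}=(s_1,\dots,s_r)$ of positive integers with $s_1+\cdots+s_r=7$ there exist constants $\alpha,\alpha'\in\mathbb{Q}(2)$, independent of $p$, such that for every prime $p>7$ $$S_{p-1}(\mathbf{s})\equiv \alpha B_{p-7},\qquad H_{p-1}(\mathbf{s})\equiv \alpha' B_{p-7}\pmod p.$$ (ii) For every sequence $\mathbf{s}=(s_1,\dots,s_r)$ of positive integers with $s_1+\cdots+s_r=9$ there exist constants $\alpha,\beta,\alpha',\beta'\in\mathbb{Q}(3)$, independent of $p$, such that for every prime $p>7$ $$S_{p-1}(\mathbf{s})\equiv \alpha B_{p-9}+\beta B_{p-3}^3,\qquad H_{p-1}(\mathbf{s})\equiv \alpha' B_{p-9}+\beta' B_{p-3}^3\pmod p.$$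
   Context: For a sequence $\mathbf{s}=(s_1,\dots,s_r)$ of positive integers and an integer $n\ge 0$: $H_n(\mathbf{s})=\sum_{1\le k_1<\cdots<k_r\le n}\frac{1}{k_1^{s_1}\cdots k_r^{s_r}}$ and $S_n(\mathbf{s})=\sum_{1\le k_1\le\cdots\le k_r\le n}\frac{1}{k_1^{s_1}\cdots k_r^{s_r}}$, with $H_n(\mathbf{s})=0$ if $n<r$. For a positive integer $w$, $\mathbb{Q}(w)$ denotes the set of rational numbers $u/v$ which, when written in reduced form, have the property that every prime $q$ dividing $v$ satisfies $q\le w$. $B_k$ are the Bernoulli numbers defined by $\frac{x}{e^x-1}=\sum_{k\ge0}B_k\frac{x^k}{k!}$. For rational numbers $x,y$, $x\equiv y\pmod{p}$ means that $x-y$ has $p$-adic valuation at least $1$. *)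

theory Defs
  imports "HOL-Computational_Algebra.Computational_Algebra"
begin

definition mhs :: "nat \<Rightarrow> nat list \<Rightarrow> rat" where
  "mhs n s = (\<Sum>k | length k = length s \<and> set k \<subseteq> {1..n} \<and> sorted_wrt (<) k.
                \<Prod>i<length s. 1 / of_nat (k ! i) ^ (s ! i))"

definition mhs_star :: "nat \<Rightarrow> nat list \<Rightarrow> rat" where
  "mhs_star n s = (\<Sum>k | length k = length s \<and> set k \<subseteq> {1..n} \<and> sorted_wrt (\<le>) k.
                     \<Prod>i<length s. 1 / of_nat (k ! i) ^ (s ! i))"

definition Q_smooth :: "nat \<Rightarrow> rat set" where
  "Q_smooth w = {x. \<forall>q::nat. prime q \<longrightarrow> int q dvd snd (quotient_of x) \<longrightarrow> q \<le> w}"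

definition bernoulli :: "nat \<Rightarrow> rat" where
  "bernoulli k = fact k * fps_nth (fps_X / (fps_exp 1 - 1)) k"

text \<open>The quotient of power series above is exact, although its denominator has
  no constant term.\<close>

lemma bernoulli_generating_function:
  "Abs_fps (\<lambda>k. bernoulli k / fact k) * (fps_exp 1 - 1) = fps_X"
proof -
  let ?e = "fps_exp 1 - 1 :: rat fps"
  have nz: "fps_nth ?e 1 \<noteq> 0" by simp
  then have "?e \<noteq> 0" by (metis fps_zero_nth)
  moreover have "subdegree ?e \<le> subdegree (fps_X :: rat fps)"
    using subdegree_leI[OF nz] by simp
  ultimately have "fps_X / ?e * ?e = fps_X"
    by (metis dvd_div_mult_self fps_X_neq_zero fps_dvd_iff)
  moreover have "Abs_fps (\<lambda>k. bernoulli k / fact k) = fps_X / ?e"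
    by (rule fps_ext) (simp add: bernoulli_def)
  ultimately show ?thesis by simp
qed

text \<open>The \<open>p\<close>-adic valuation of a nonzero rational number. Its value at \<open>0\<close>
  (conventionally infinite) is irrelevant: the congruence below treats that case separately.\<close>

definition rat_valuation :: "nat \<Rightarrow> rat \<Rightarrow> int" where
  "rat_valuation p x = int (multiplicity (int p) (fst (quotient_of x)))
                     - int (multiplicity (int p) (snd (quotient_of x)))"

definition rat_cong :: "rat \<Rightarrow> rat \<Rightarrow> nat \<Rightarrow> bool" where
  "rat_cong x y p \<longleftrightarrow> x - y = 0 \<or> rat_valuation p (x - y) \<ge> 1"

end

theory Submission
  imports Defs "HOL-Number_Theory.Number_Theory"
begin

text \<open>Fix a weight \<open>w\<close> and compute modulo a prime \<open>p > 7\<close>. The sums \<open>H\<^sub>p\<^sub>-\<^sub>1(s)\<close> of weight \<open>w\<close>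
  satisfy so many relations that only few of them remain free.

  \<^item> The stuffle product (\<open>H_mult\<close>) writes the product of two sums as a sum of sums.
  \<^item> The shuffle product of polylogarithms, read off at the coefficients below \<open>p\<close>, gives the linear
    relation \<open>shuffle_relation\<close>; its simplest case says that reversing \<open>s\<close> multiplies \<open>H\<^sub>p\<^sub>-\<^sub>1(s)\<close>
    by \<open>(-1)\<^sup>w\<close>.
  \<^item> The antipode relation (\<open>antipode\<close>) shows that, modulo products of sums of smaller weight, a sum
    whose depth has the parity of \<open>w\<close> is half of an integral combination of sums of smaller depth.
  \<^item> Duality (\<open>duality\<close>) identifies, up to sign, a sum \<open>S\<^sub>p\<^sub>-\<^sub>1\<close> of depth \<open>r\<close> with one of depth
    \<open>w + 1 - r\<close>. Together with the triangular passage between \<open>S\<close> and \<open>H\<close> this settles all depths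
    as soon as the depths up to \<open>w / 2\<close>, rounded up, are settled.

  Bernoulli numbers enter in depth two: a sum of depth one is \<open>0\<close>, and by Faulhaber's formula a sum of
  depth two is an explicit multiple of \<open>B\<^sub>p\<^sub>-\<^sub>w\<close> (\<open>H_depth_2\<close>). These facts alone give that all sums of
  weight 1, 2 and 4 vanish and that those of weight 3 are multiples of \<open>B\<^sub>p\<^sub>-\<^sub>3\<close>. Hence products of sums
  vanish in total weight 7, are multiples of \<open>B\<^sub>p\<^sub>-\<^sub>3\<^sup>2\<close> in weight 6 and, because only weights 3 and 6 can
  occur together, multiples of \<open>B\<^sub>p\<^sub>-\<^sub>3\<^sup>3\<close> in weight 9.

  What is left is depth 3 in weight 6 and depth 4 in weights 7 and 9. There the stuffle and shuffle
  relations form a linear system for the sums, modulo products and sums of smaller depth, and explicit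
  lists of relations have a matrix that is invertible over \<open>\<int>[1/2]\<close> in weight 7 and over \<open>\<int>[1/6]\<close> in
  weights 6 and 9 (\<open>certificate_6\<close>, \<open>certificate_7\<close>, \<open>certificate_9\<close>). The multiples of \<open>B\<^sub>p\<^sub>-\<^sub>w\<close> in
  depth two are integral for \<open>w = 7\<close> and have denominators 1 or 3 for \<open>w = 9\<close>, and every later division
  is by a number with no prime factor other than 2, respectively 2 and 3. This is the claim about the
  constants. Their values are not computed: the sequences that are of the required form are closed
  under the operations used.\<close>

section \<open>Congruences between p-integral rational numbers\<close>

text \<open>The localisation of the integers at \<open>p\<close>, inside the rational numbers.\<close>

definition p_integral :: "nat \<Rightarrow> rat \<Rightarrow> bool" where
  "p_integral p x \<longleftrightarrow> (\<exists>a b. \<not> int p dvd b \<and> x = of_int a / of_int b)"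

lemma p_integral_of_int [simp]: "prime p \<Longrightarrow> p_integral p (of_int a)"
  unfolding p_integral_def
  by (rule exI[of _ a], rule exI[of _ 1]) (auto dest: prime_gt_1_nat)

lemma p_integral_0 [simp]: "prime p \<Longrightarrow> p_integral p 0"
  and p_integral_1 [simp]: "prime p \<Longrightarrow> p_integral p 1"
  and p_integral_of_nat [simp]: "prime p \<Longrightarrow> p_integral p (of_nat n)"
  and p_integral_numeral [simp]: "prime p \<Longrightarrow> p_integral p (numeral m)"
  using p_integral_of_int[of p 0] p_integral_of_int[of p 1] p_integral_of_int[of p "int n"]
    p_integral_of_int[of p "numeral m"] by auto

lemma p_integral_add [simp]:
  assumes "prime p" "p_integral p x" "p_integral p y"
  shows "p_integral p (x + y)"
proof -
  obtain a b where ab: "\<not> int p dvd b" "x = of_int a / of_int b"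
    using assms unfolding p_integral_def by blast
  obtain c d where cd: "\<not> int p dvd d" "y = of_int c / of_int d"
    using assms unfolding p_integral_def by blast
  have nz: "b \<noteq> 0" "d \<noteq> 0" using ab cd by auto
  have "\<not> int p dvd b * d" using ab cd assms(1) by (simp add: prime_dvd_mult_iff)
  moreover have "x + y = of_int (a * d + c * b) / of_int (b * d)"
    using nz ab cd by (simp add: field_simps)
  ultimately show ?thesis unfolding p_integral_def by blast
qed

lemma p_integral_mult [simp]:
  assumes "prime p" "p_integral p x" "p_integral p y"
  shows "p_integral p (x * y)"
proof -
  obtain a b where ab: "\<not> int p dvd b" "x = of_int a / of_int b"
    using assms unfolding p_integral_def by blast
  obtain c d where cd: "\<not> int p dvd d" "y = of_int c / of_int d"
    using assms unfolding p_integral_def by blast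
  have "\<not> int p dvd b * d" using ab cd assms(1) by (simp add: prime_dvd_mult_iff)
  moreover have "x * y = of_int (a * c) / of_int (b * d)"
    using ab cd by simp
  ultimately show ?thesis unfolding p_integral_def by blast
qed

lemma p_integral_minus [simp]: "prime p \<Longrightarrow> p_integral p x \<Longrightarrow> p_integral p (- x)"
  using p_integral_mult[of p "-1" x] p_integral_of_int[of p "-1"] by simp

lemma p_integral_diff [simp]:
  "prime p \<Longrightarrow> p_integral p x \<Longrightarrow> p_integral p y \<Longrightarrow> p_integral p (x - y)"
  using p_integral_add[of p x "-y"] by simp

lemma p_integral_power [simp]: "prime p \<Longrightarrow> p_integral p x \<Longrightarrow> p_integral p (x ^ n)"
  by (induction n) auto

lemma p_integral_sum [simp]:
  "prime p \<Longrightarrow> (\<And>i. i \<in> A \<Longrightarrow> p_integral p (f i)) \<Longrightarrow> p_integral p (sum f A)"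
  by (induction A rule: infinite_finite_induct) auto

lemma p_integral_divide_of_int [simp]:
  assumes "prime p" "p_integral p x" "\<not> int p dvd c"
  shows "p_integral p (x / of_int c)"
proof -
  have "p_integral p (of_int 1 / of_int c)"
    unfolding p_integral_def using assms(3) by blast
  then have "p_integral p (x * (of_int 1 / of_int c))" using assms by (intro p_integral_mult)
  then show ?thesis by simp
qed

lemma p_integral_divide_of_nat [simp]:
  assumes "prime p" "p_integral p x" "\<not> p dvd c"
  shows "p_integral p (x / of_nat c)"
  using p_integral_divide_of_int[of p x "int c"] assms by (simp add: int_dvd_int_iff)

lemma p_integral_divide_lt:
  assumes "prime p" "p_integral p x" "0 < c" "c < p"
  shows "p_integral p (x / of_nat c)"
  using assms by (intro p_integral_divide_of_nat) (auto dest: dvd_imp_le)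

text \<open>In lowest terms at most one of numerator and denominator is divisible by \<open>p\<close>, so a valuation of at
  least 1 means that \<open>p\<close> divides the numerator. This form of the congruence makes its compatibility
  with the ring operations a matter of closure of the \<open>p\<close>-integral numbers.\<close>

lemma rat_cong_iff:
  assumes "prime p"
  shows "rat_cong x y p \<longleftrightarrow> p_integral p ((x - y) / of_nat p)"
proof (cases "x - y = 0")
  case True
  then show ?thesis using assms by (simp add: rat_cong_def)
next
  case False
  have p: "prime (int p)" using assms by simp
  define d where "d = x - y"
  obtain a b where q: "quotient_of d = (a, b)" by (cases "quotient_of d") auto
  have b: "b > 0" and cop: "coprime a b" and d: "d = of_int a / of_int b"
    using quotient_of_denom_pos[OF q] quotient_of_coprime[OF q] quotient_of_div[OF q] by auto
  have a0: "a \<noteq> 0" using False d by (auto simp: d_def)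
  have val: "rat_valuation p d = int (multiplicity (int p) a) - int (multiplicity (int p) b)"
    by (simp add: rat_valuation_def q)
  have ndvd: "\<not> (int p dvd a \<and> int p dvd b)"
    using cop p by (meson coprime_common_divisor not_prime_unit)
  have "rat_valuation p d \<ge> 1 \<longleftrightarrow> int p dvd a"
  proof
    assume "rat_valuation p d \<ge> 1"
    then have "multiplicity (int p) a \<noteq> 0" using val by linarith
    then show "int p dvd a" using not_dvd_imp_multiplicity_0[of "int p" a] by argo
  next
    assume pa: "int p dvd a"
    then have "multiplicity (int p) b = 0"
      using ndvd not_dvd_imp_multiplicity_0[of "int p" b] by argo
    moreover have "multiplicity (int p) a > 0"
      using pa a0 p by (simp add: prime_multiplicity_gt_zero_iff)
    ultimately show "rat_valuation p d \<ge> 1" using val by simp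
  qed
  also have "int p dvd a \<longleftrightarrow> p_integral p (d / of_nat p)"
  proof
    assume "int p dvd a"
    then obtain e where e: "a = int p * e" by blast
    have "\<not> int p dvd b" using ndvd \<open>int p dvd a\<close> by blast
    moreover have "d / of_nat p = of_int e / of_int b"
      using d e assms by (auto simp: prime_gt_0_nat)
    ultimately show "p_integral p (d / of_nat p)" unfolding p_integral_def by blast
  next
    assume "p_integral p (d / of_nat p)"
    then obtain e f where f: "\<not> int p dvd f" and ef: "d / of_nat p = of_int e / of_int f"
      unfolding p_integral_def by blast
    have "f \<noteq> 0" "p \<noteq> 0" using f assms by auto
    then have "of_int a * of_int f = (of_nat p * of_int e * of_int b :: rat)"
      using ef b unfolding d by (simp add: field_simps)
    then have "(of_int (a * f) :: rat) = of_int (int p * e * b)" by simp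
    then have "a * f = int p * e * b" by (simp only: of_int_eq_iff)
    then have "int p dvd a * f" by simp
    then show "int p dvd a" using f p by (simp add: prime_dvd_mult_iff)
  qed
  finally show ?thesis using False by (simp add: rat_cong_def d_def)
qed

lemma rat_cong_refl [simp]: "rat_cong x x p"
  by (simp add: rat_cong_def)

lemma rat_cong_sym: "prime p \<Longrightarrow> rat_cong x y p \<Longrightarrow> rat_cong y x p"
  using p_integral_minus[of p "(x - y) / of_nat p"]
  by (simp add: rat_cong_iff minus_divide_left)

lemma rat_cong_trans [trans]:
  "rat_cong x y p \<Longrightarrow> rat_cong y z p \<Longrightarrow> prime p \<Longrightarrow> rat_cong x z p"
  using p_integral_add[of p "(x - y) / of_nat p" "(y - z) / of_nat p"]
  by (simp add: rat_cong_iff add_divide_distrib[symmetric])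

lemma rat_cong_add:
  "prime p \<Longrightarrow> rat_cong x y p \<Longrightarrow> rat_cong z w p \<Longrightarrow> rat_cong (x + z) (y + w) p"
  using p_integral_add[of p "(x - y) / of_nat p" "(z - w) / of_nat p"]
  by (simp add: rat_cong_iff add_divide_distrib[symmetric] algebra_simps)

lemma rat_cong_mult:
  assumes "prime p" "p_integral p x" "p_integral p w" "rat_cong x y p" "rat_cong z w p"
  shows "rat_cong (x * z) (y * w) p"
proof -
  have "p_integral p (x * ((z - w) / of_nat p) + w * ((x - y) / of_nat p))"
    using assms by (intro p_integral_add p_integral_mult) (auto simp: rat_cong_iff)
  also have "x * ((z - w) / of_nat p) + w * ((x - y) / of_nat p) = (x * z - y * w) / of_nat p"
    by (simp add: add_divide_distrib[symmetric] algebra_simps)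
  finally show ?thesis using assms(1) by (simp add: rat_cong_iff)
qed

lemma rat_cong_p_integral:
  assumes "prime p" "rat_cong x y p" "p_integral p y"
  shows "p_integral p x"
proof -
  have "p_integral p (y + of_nat p * ((x - y) / of_nat p))"
    using assms by (intro p_integral_add p_integral_mult) (auto simp: rat_cong_iff)
  then show ?thesis using assms(1) by (simp add: prime_gt_0_nat)
qed

lemma rat_cong_mult_left:
  "prime p \<Longrightarrow> p_integral p c \<Longrightarrow> rat_cong x y p \<Longrightarrow> rat_cong (c * x) (c * y) p"
  using p_integral_mult[of p c "(x - y) / of_nat p"]
  by (simp add: rat_cong_iff algebra_simps diff_divide_distrib)

lemma rat_cong_mult_right:
  "prime p \<Longrightarrow> p_integral p c \<Longrightarrow> rat_cong x y p \<Longrightarrow> rat_cong (x * c) (y * c) p"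
  using rat_cong_mult_left[of p c x y] by (simp add: mult.commute)

lemma rat_cong_sum:
  "prime p \<Longrightarrow> (\<And>i. i \<in> A \<Longrightarrow> rat_cong (f i) (g i) p) \<Longrightarrow> rat_cong (sum f A) (sum g A) p"
  by (induction A rule: infinite_finite_induct) (auto intro: rat_cong_add)

lemma rat_cong_power:
  assumes "prime p" "p_integral p y" "rat_cong x y p"
  shows "rat_cong (x ^ n) (y ^ n) p"
proof (induction n)
  case (Suc n)
  have "p_integral p x" using rat_cong_p_integral assms by blast
  then show ?case using assms Suc by (auto intro!: rat_cong_mult)
qed simp

lemma rat_cong_inverse:
  assumes "prime p" "p_integral p (1 / x)" "p_integral p (1 / y)" "rat_cong x y p"
    "x \<noteq> 0" "y \<noteq> 0"
  shows "rat_cong (1 / x) (1 / y) p"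
proof -
  have "p_integral p (- (1 / x) * (1 / y) * ((x - y) / of_nat p))"
    using assms by (intro p_integral_mult p_integral_minus) (auto simp: rat_cong_iff)
  also have "- (1 / x) * (1 / y) * ((x - y) / of_nat p) = (1 / x - 1 / y) / of_nat p"
    using assms by (simp add: field_simps)
  finally show ?thesis using assms(1) by (simp add: rat_cong_iff)
qed

lemma rat_cong_of_int:
  assumes "prime p" "[a = b] (mod int p)"
  shows "rat_cong (of_int a) (of_int b) p"
proof -
  obtain k where "a - b = int p * k" using assms(2) by (auto simp: cong_iff_dvd_diff)
  then have "of_int a - of_int b = (of_int (int p * k) :: rat)" by (metis of_int_diff)
  then have "(of_int a - of_int b :: rat) / of_nat p = of_int k"
    using assms(1) by (auto simp: prime_gt_0_nat)
  then show ?thesis using assms(1) by (simp add: rat_cong_iff)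
qed

lemma rat_cong_p_0: "prime p \<Longrightarrow> p_integral p x \<Longrightarrow> rat_cong (of_nat p * x) 0 p"
  by (auto simp: rat_cong_iff prime_gt_0_nat)

section \<open>Harmonic sums, reflection and the antipode\<close>

text \<open>The exponents are listed in the order opposite to the customary one: the head belongs to the largest
  summation index. The recursion then removes the largest index and bounds the remaining ones by it.\<close>

primrec H :: "nat list \<Rightarrow> nat \<Rightarrow> rat" where
  "H [] = (\<lambda>n. 1)"
| "H (a # s) = (\<lambda>n. \<Sum>k=1..n. H s (k - 1) / of_nat k ^ a)"

primrec S :: "nat list \<Rightarrow> nat \<Rightarrow> rat" where
  "S [] = (\<lambda>n. 1)"
| "S (a # s) = (\<lambda>n. \<Sum>k=1..n. S s k / of_nat k ^ a)"

text \<open>Summing over the last, hence largest, entry first. The bound \<open>b\<close> is \<open>m - 1\<close> for strictly and \<open>m\<close> for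
  weakly increasing chains.\<close>

lemma sum_over_chains_snoc:
  fixes R :: "nat \<Rightarrow> nat \<Rightarrow> bool" and s :: "nat list"
  defines "K \<equiv> \<lambda>n r. {k. length k = r \<and> set k \<subseteq> {1..n} \<and> sorted_wrt R k}"
  defines "f \<equiv> \<lambda>s k. \<Prod>i<length s. 1 / (of_nat (k ! i) :: rat) ^ (s ! i)"
  assumes R: "\<And>x m. 1 \<le> m \<Longrightarrow> m \<le> n \<Longrightarrow> (x \<le> n \<and> R x m) \<longleftrightarrow> x \<le> b m"
  shows "sum (f (s @ [a])) (K n (length (s @ [a]))) =
         (\<Sum>m=1..n. sum (f s) (K (b m) (length s)) / of_nat m ^ a)"
proof -
  let ?D = "SIGMA m:{1..n}. K (b m) (length s)"
  have eq: "K n (length (s @ [a])) = (\<lambda>(m, k). k @ [m]) ` ?D"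
  proof (intro subset_antisym subsetI)
    fix l assume "l \<in> K n (length (s @ [a]))"
    then have l: "length l = Suc (length s)" "set l \<subseteq> {1..n}" "sorted_wrt R l"
      by (auto simp: K_def)
    then obtain k m where km: "l = k @ [m]" by (metis length_Suc_conv_rev)
    have m: "m \<in> {1..n}" using l km by auto
    have "x \<le> b m" if "x \<in> set k" for x
    proof -
      have "R x m" "x \<le> n" using that l km by (auto simp: sorted_wrt_append)
      then show ?thesis using R[of m x] m by auto
    qed
    then have "k \<in> K (b m) (length s)"
      using l km by (auto simp: K_def sorted_wrt_append)
    then show "l \<in> (\<lambda>(m, k). k @ [m]) ` ?D" using m km by auto
  next
    fix l assume "l \<in> (\<lambda>(m, k). k @ [m]) ` ?D"
    then obtain m k where mk: "m \<in> {1..n}" "k \<in> K (b m) (length s)" "l = k @ [m]" by auto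
    have "x \<le> n \<and> R x m" if "x \<in> set k" for x
      using that R[of m x] mk by (auto simp: K_def)
    then show "l \<in> K n (length (s @ [a]))"
      using mk by (auto simp: K_def sorted_wrt_append subset_iff)
  qed
  have inj: "inj_on (\<lambda>(m, k). k @ [m]) ?D" by (auto simp: inj_on_def)
  have fin: "finite (K m r)" for m r
    unfolding K_def by (rule finite_subset[OF _ finite_lists_length_eq[of "{1..m}" r]]) auto
  have f: "f (s @ [a]) (k @ [m]) = f s k / of_nat m ^ a" if "length k = length s" for k m
    using that by (simp add: f_def nth_append)
  have "sum (f (s @ [a])) (K n (length (s @ [a]))) =
        (\<Sum>(m, k)\<in>?D. f (s @ [a]) (k @ [m]))"
    unfolding eq by (subst sum.reindex[OF inj]) (simp add: case_prod_unfold o_def)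
  also have "\<dots> = (\<Sum>(m, k)\<in>?D. f s k / of_nat m ^ a)"
    by (rule sum.cong) (auto simp: f K_def)
  also have "\<dots> = (\<Sum>m=1..n. \<Sum>k\<in>K (b m) (length s). f s k / of_nat m ^ a)"
    by (rule sum.Sigma[symmetric]) (auto simp: fin)
  also have "\<dots> = (\<Sum>m=1..n. sum (f s) (K (b m) (length s)) / of_nat m ^ a)"
    by (simp add: sum_divide_distrib)
  finally show ?thesis .
qed

lemma mhs_eq_H: "mhs n s = H (rev s) n"
proof (induction s arbitrary: n rule: rev_induct)
  case Nil
  have "{k :: nat list. k = [] \<and> set k \<subseteq> {1..n} \<and> sorted_wrt (<) k} = {[]}" by auto
  then show ?case by (simp add: mhs_def)
next
  case (snoc a s)
  have "mhs n (s @ [a]) = (\<Sum>m=1..n. mhs (m - 1) s / of_nat m ^ a)"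
    unfolding mhs_def by (rule sum_over_chains_snoc) auto
  then show ?case by (simp add: snoc)
qed

lemma mhs_star_eq_S: "mhs_star n s = S (rev s) n"
proof (induction s arbitrary: n rule: rev_induct)
  case Nil
  have "{k :: nat list. k = [] \<and> set k \<subseteq> {1..n} \<and> sorted_wrt (\<le>) k} = {[]}" by auto
  then show ?case by (simp add: mhs_star_def)
next
  case (snoc a s)
  have "mhs_star n (s @ [a]) = (\<Sum>m=1..n. mhs_star m s / of_nat m ^ a)"
    unfolding mhs_star_def by (rule sum_over_chains_snoc) auto
  then show ?case by (simp add: snoc)
qed

lemma p_integral_divide_power:
  "prime p \<Longrightarrow> p_integral p x \<Longrightarrow> 0 < k \<Longrightarrow> k < p \<Longrightarrow> p_integral p (x / of_nat k ^ a)"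
  using p_integral_divide_of_nat[of p x "k ^ a"] prime_dvd_power[of p k a] dvd_imp_le[of p k]
  by auto

lemma p_integral_H: "prime p \<Longrightarrow> n < p \<Longrightarrow> p_integral p (H s n)"
  by (induction s arbitrary: n) (auto intro!: p_integral_sum p_integral_divide_power)

lemma p_integral_S: "prime p \<Longrightarrow> n < p \<Longrightarrow> p_integral p (S s n)"
  by (induction s arbitrary: n) (auto intro!: p_integral_sum p_integral_divide_power)

text \<open>The substitution \<open>k \<mapsto> p - k\<close> reverses the order of the summation indices and turns an upper bound into
  a lower bound. The resulting sums have the smallest index at the head and are bounded below by the
  last argument, strictly for \<open>H_asc\<close> and weakly for \<open>S_asc\<close>.\<close>

primrec H_asc :: "nat \<Rightarrow> nat list \<Rightarrow> nat \<Rightarrow> rat" where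
  "H_asc n [] = (\<lambda>m. 1)"
| "H_asc n (a # s) = (\<lambda>m. \<Sum>k=Suc m..n. H_asc n s k / of_nat k ^ a)"

primrec S_asc :: "nat \<Rightarrow> nat list \<Rightarrow> nat \<Rightarrow> rat" where
  "S_asc n [] = (\<lambda>m. 1)"
| "S_asc n (a # s) = (\<lambda>m. \<Sum>k=m..n. S_asc n s k / of_nat k ^ a)"

lemma rat_cong_reflect_power:
  assumes "prime p" "0 < k" "k < p"
  shows "rat_cong (1 / of_nat (p - k) ^ a) ((-1) ^ a * (1 / of_nat k ^ a)) p"
proof -
  have "rat_cong (of_int (int (p - k))) (of_int (- int k)) p"
    using assms by (intro rat_cong_of_int) (auto simp: cong_iff_dvd_diff of_nat_diff)
  then have c: "rat_cong (of_nat (p - k)) (- of_nat k) p" by simp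
  have "p_integral p (- (1 / of_nat k ^ 1))"
    using assms by (intro p_integral_minus p_integral_divide_power) auto
  moreover have "p_integral p (1 / of_nat (p - k) ^ 1)"
    using assms by (intro p_integral_divide_power) auto
  ultimately have "rat_cong (1 / of_nat (p - k)) (1 / (- of_nat k)) p"
    using assms c by (intro rat_cong_inverse) auto
  moreover have "p_integral p (1 / (- of_nat k))"
    using \<open>p_integral p (- (1 / of_nat k ^ 1))\<close> by simp
  ultimately have "rat_cong ((1 / of_nat (p - k)) ^ a) ((1 / (- of_nat k)) ^ a) p"
    using assms by (intro rat_cong_power)
  then show ?thesis by (simp add: power_one_over power_divide power_minus[of "1 / _"])
qed

lemma p_integral_minus_one_power: "prime p \<Longrightarrow> p_integral p ((-1) ^ n)"
  by (simp add: p_integral_of_int)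

lemma H_reflect:
  assumes "prime p" "m < p"
  shows "rat_cong (H s (p - 1 - m)) ((-1) ^ sum_list s * H_asc (p - 1) s m) p"
  using assms(2)
proof (induction s arbitrary: m)
  case (Cons a s)
  have "H (a # s) (p - 1 - m) = (\<Sum>k=Suc m..p - 1. H s (p - 1 - k) * (1 / of_nat (p - k) ^ a))"
    unfolding H.simps
    by (rule sum.reindex_bij_witness[of _ "\<lambda>k. p - k" "\<lambda>k. p - k"])
       (use Cons.prems in \<open>auto simp: diff_commute\<close>)
  also have "rat_cong \<dots> (\<Sum>k=Suc m..p - 1. ((-1) ^ sum_list s * H_asc (p - 1) s k) *
      ((-1) ^ a * (1 / of_nat k ^ a))) p"
  proof (intro rat_cong_sum rat_cong_mult)
    fix k assume k: "k \<in> {Suc m..p - 1}"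
    show "p_integral p ((-1) ^ a * (1 / of_nat k ^ a))"
      using k assms by (intro p_integral_mult p_integral_minus_one_power p_integral_divide_power) auto
    show "p_integral p (H s (p - 1 - k))" using k assms by (intro p_integral_H) auto
    show "rat_cong (H s (p - 1 - k)) ((-1) ^ sum_list s * H_asc (p - 1) s k) p"
      using k by (intro Cons.IH) auto
    show "rat_cong (1 / of_nat (p - k) ^ a) ((-1) ^ a * (1 / of_nat k ^ a)) p"
      using k assms by (intro rat_cong_reflect_power) auto
  qed (use assms in auto)
  finally show ?case
    by (simp add: sum_distrib_left power_add mult_ac)
qed simp

lemma S_reflect:
  assumes "prime p" "0 < m" "m \<le> p"
  shows "rat_cong (S s (p - m)) ((-1) ^ sum_list s * S_asc (p - 1) s m) p"
  using assms(2,3)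
proof (induction s arbitrary: m)
  case (Cons a s)
  have "S (a # s) (p - m) = (\<Sum>k=m..p - 1. S s (p - k) * (1 / of_nat (p - k) ^ a))"
    unfolding S.simps
    by (rule sum.reindex_bij_witness[of _ "\<lambda>k. p - k" "\<lambda>k. p - k"])
       (use Cons.prems in \<open>auto simp: diff_commute\<close>)
  also have "rat_cong \<dots> (\<Sum>k=m..p - 1. ((-1) ^ sum_list s * S_asc (p - 1) s k) *
      ((-1) ^ a * (1 / of_nat k ^ a))) p"
  proof (intro rat_cong_sum rat_cong_mult)
    fix k assume k: "k \<in> {m..p - 1}"
    show "p_integral p ((-1) ^ a * (1 / of_nat k ^ a))"
      using k assms Cons.prems
      by (intro p_integral_mult p_integral_minus_one_power p_integral_divide_power) auto
    show "p_integral p (S s (p - k))" using k assms Cons.prems by (intro p_integral_S) auto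
    show "rat_cong (S s (p - k)) ((-1) ^ sum_list s * S_asc (p - 1) s k) p"
      using k Cons.prems by (intro Cons.IH) auto
    show "rat_cong (1 / of_nat (p - k) ^ a) ((-1) ^ a * (1 / of_nat k ^ a)) p"
      using k assms Cons.prems by (intro rat_cong_reflect_power) auto
  qed (use assms in auto)
  finally show ?case
    by (simp add: sum_distrib_left power_add mult_ac)
qed simp

text \<open>The term for \<open>i\<close> runs over indices that decrease strictly up to position \<open>i\<close> and increase weakly
  afterwards. Comparing the indices at positions \<open>i\<close> and \<open>i + 1\<close> splits it into two parts, each of which
  cancels against a part of a neighbouring term. For \<open>N < n\<close> the cancellation is incomplete, since the
  decreasing part is bounded by \<open>N\<close> and the increasing part by \<open>n\<close>; this version makes the induction
  work.\<close>

lemma antipode_asc: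
  assumes "N \<le> n"
  shows "(\<Sum>i\<le>length s. (-1) ^ i * H (take i s) N * S_asc n (drop i s) 1) = S_asc n s (Suc N)"
  using assms
proof (induction s arbitrary: N)
  case (Cons a s)
  have "(\<Sum>i\<le>length (a # s). (-1) ^ i * H (take i (a # s)) N * S_asc n (drop i (a # s)) 1) =
        S_asc n (a # s) 1 -
        (\<Sum>i\<le>length s. \<Sum>k=1..N. (-1) ^ i * H (take i s) (k - 1) * S_asc n (drop i s) 1 / of_nat k ^ a)"
    by (simp add: sum.atMost_Suc_shift sum_distrib_left sum_distrib_right sum_negf mult_ac
             del: S_asc.simps(2) sum.atMost_Suc)
  also have "(\<Sum>i\<le>length s. \<Sum>k=1..N. (-1) ^ i * H (take i s) (k - 1) * S_asc n (drop i s) 1 / of_nat k ^ a)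
        = (\<Sum>k=1..N. (\<Sum>i\<le>length s. (-1) ^ i * H (take i s) (k - 1) * S_asc n (drop i s) 1) / of_nat k ^ a)"
    by (subst sum.swap) (simp add: sum_divide_distrib)
  also have "\<dots> = (\<Sum>k=1..N. S_asc n s k / of_nat k ^ a)"
    using Cons by (intro sum.cong) auto
  also have "S_asc n (a # s) 1 - \<dots> = (\<Sum>k=Suc N..n. S_asc n s k / of_nat k ^ a)"
  proof -
    have "{1..n} = {1..N} \<union> {Suc N..n}" using Cons.prems by auto
    then have "S_asc n (a # s) 1 = (\<Sum>k=1..N. S_asc n s k / of_nat k ^ a) +
        (\<Sum>k=Suc N..n. S_asc n s k / of_nat k ^ a)"
      by (simp add: sum.union_disjoint)
    then show ?thesis by simp
  qed
  finally show ?case by simp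
qed simp

text \<open>With both bounds equal to \<open>p - 1\<close> the sum is exactly \<open>0\<close>; reflection turns the weakly increasing sums
  back into the sums \<open>S\<close>.\<close>

lemma antipode:
  assumes "prime p" "s \<noteq> []"
  shows "rat_cong (\<Sum>i\<le>length s. (-1) ^ (i + sum_list (drop i s)) * H (take i s) (p - 1) *
           S (drop i s) (p - 1)) 0 p"
proof -
  have reflect: "rat_cong (S t (p - 1)) ((-1) ^ sum_list t * S_asc (p - 1) t 1) p" for t
    using S_reflect[of p 1 t] assms(1) prime_ge_1_nat by simp
  have "rat_cong (\<Sum>i\<le>length s. (-1) ^ (i + sum_list (drop i s)) * H (take i s) (p - 1) * S (drop i s) (p - 1))
     (\<Sum>i\<le>length s. (-1) ^ (i + sum_list (drop i s)) * H (take i s) (p - 1) *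
        ((-1) ^ sum_list (drop i s) * S_asc (p - 1) (drop i s) 1)) p"
    using assms
    by (intro rat_cong_sum rat_cong_mult_left p_integral_mult p_integral_H
         p_integral_minus_one_power reflect) (auto simp: prime_gt_0_nat)
  also have "(\<Sum>i\<le>length s. (-1) ^ (i + sum_list (drop i s)) * H (take i s) (p - 1) *
        ((-1) ^ sum_list (drop i s) * S_asc (p - 1) (drop i s) 1)) =
      (\<Sum>i\<le>length s. (-1) ^ i * H (take i s) (p - 1) * S_asc (p - 1) (drop i s) 1)"
    by (intro sum.cong) (auto simp: power_add minus_one_power_iff)
  also have "\<dots> = S_asc (p - 1) s p"
    using antipode_asc[of "p - 1" "p - 1" s] assms by (simp add: prime_gt_0_nat)
  also have "\<dots> = 0"
    using assms by (cases s) (auto simp: prime_gt_0_nat)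
  finally show ?thesis .
qed

section \<open>Coarsenings and the stuffle product\<close>

text \<open>The lists obtained by adding up blocks of adjacent entries, the list itself coming first.\<close>

fun coarsenings :: "nat list \<Rightarrow> nat list list" where
  "coarsenings (a # b # s) = map ((#) a) (coarsenings (b # s)) @ coarsenings ((a + b) # s)"
| "coarsenings s = [s]"

text \<open>Each weak inequality between adjacent indices is either strict or an equality, and an equality adds
  the two exponents.\<close>

lemma S_eq_sum_coarsenings: "S s n = (\<Sum>t\<leftarrow>coarsenings s. H t n)"
proof (induction s arbitrary: n rule: coarsenings.induct)
  case (1 a b s)
  have swap: "(\<Sum>t\<leftarrow>L. H (a # t) n) = (\<Sum>k=1..n. (\<Sum>t\<leftarrow>L. H t (k - 1)) / of_nat k ^ a)" for L
    by (induction L) (auto simp: sum.distrib[symmetric] add_divide_distrib)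
  have S: "S (b # s) k = S (b # s) (k - 1) + S s k / of_nat k ^ b" if "0 < k" for k
    using that by (cases k) auto
  have "S (a # b # s) n = (\<Sum>k=1..n. S (b # s) k / of_nat k ^ a)" by simp
  also have "\<dots> = (\<Sum>k=1..n. S (b # s) (k - 1) / of_nat k ^ a + S s k / of_nat k ^ (a + b))"
    by (intro sum.cong refl, subst S) (auto simp: add_divide_distrib power_add)
  also have "\<dots> = (\<Sum>k=1..n. S (b # s) (k - 1) / of_nat k ^ a) + S ((a + b) # s) n"
    by (simp add: sum.distrib)
  finally show ?case by (simp add: 1 swap o_def del: H.simps S.simps)
qed auto

lemma coarsenings_Cons:
  "\<exists>L. coarsenings s = s # L \<and> (\<forall>t\<in>set L. length t < length s)"
proof (induction s rule: coarsenings.induct)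
  case (1 a b s)
  obtain L where "coarsenings (b # s) = (b # s) # L" "\<forall>t\<in>set L. length t < length (b # s)"
    using 1 by blast
  moreover obtain L' where "coarsenings ((a + b) # s) = ((a + b) # s) # L'"
    "\<forall>t\<in>set L'. length t < length ((a + b) # s)" using 1 by blast
  ultimately show ?case by auto
qed auto

lemma coarsenings_sum_list: "t \<in> set (coarsenings s) \<Longrightarrow> sum_list t = sum_list s"
  by (induction s arbitrary: t rule: coarsenings.induct) auto

lemma coarsenings_pos:
  "t \<in> set (coarsenings s) \<Longrightarrow> 0 \<notin> set s \<Longrightarrow> 0 \<notin> set t"
  by (induction s arbitrary: t rule: coarsenings.induct) auto

lemma coarsenings_Nil: "t \<in> set (coarsenings s) \<Longrightarrow> t = [] \<longleftrightarrow> s = []"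
  by (induction s arbitrary: t rule: coarsenings.induct) auto

text \<open>The three cases tell whether the largest index of the first, of the second, or of both factors is the
  largest one. The result is a list, not a set, because it has to count repetitions.\<close>

fun stuffle :: "nat list \<Rightarrow> nat list \<Rightarrow> nat list list" where
  "stuffle (a # s) (b # t) = map ((#) a) (stuffle s (b # t)) @ map ((#) b) (stuffle (a # s) t) @
     map ((#) (a + b)) (stuffle s t)"
| "stuffle s t = [s @ t]"

lemma stuffle_Nil [simp]: "stuffle [] t = [t]" "stuffle s [] = [s]"
  by (cases s; simp)+

lemma H_Cons_Suc: "H (a # s) (Suc n) = H (a # s) n + H s n / of_nat (Suc n) ^ a"
  by simp

lemma sum_list_map_H_Cons_Suc:
  "(\<Sum>w\<leftarrow>map ((#) a) L. H w (Suc n)) =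
   (\<Sum>w\<leftarrow>map ((#) a) L. H w n) + (\<Sum>w\<leftarrow>L. H w n) / of_nat (Suc n) ^ a"
  by (induction L) (simp_all add: add_divide_distrib)

lemma H_mult: "H s n * H t n = (\<Sum>w\<leftarrow>stuffle s t. H w n)"
proof (induction s t arbitrary: n rule: stuffle.induct)
  case (1 a s b t)
  note IH = 1
  show ?case
  proof (induction n)
    case 0
    have "(\<Sum>w\<leftarrow>map ((#) c) L. H w 0) = 0" for c L by (induction L) auto
    then show ?case by simp
  next
    case (Suc n)
    let ?d = "of_nat (Suc n) :: rat"
    have "H (a # s) (Suc n) * H (b # t) (Suc n) =
      H (a # s) n * H (b # t) n + (H s n * H (b # t) n) / ?d ^ a +
      (H (a # s) n * H t n) / ?d ^ b + (H s n * H t n) / ?d ^ (a + b)"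
      unfolding H_Cons_Suc by (simp add: algebra_simps power_add add_divide_distrib del: H.simps of_nat_Suc)
    also have "\<dots> = (\<Sum>w\<leftarrow>stuffle (a # s) (b # t). H w (Suc n))"
      unfolding Suc IH stuffle.simps map_append sum_list_append sum_list_map_H_Cons_Suc by simp
    finally show ?case .
  qed
qed auto

lemma stuffle_sum_list: "w \<in> set (stuffle s t) \<Longrightarrow> sum_list w = sum_list s + sum_list t"
  by (induction s t arbitrary: w rule: stuffle.induct) auto

lemma stuffle_pos: "w \<in> set (stuffle s t) \<Longrightarrow> 0 \<notin> set s \<Longrightarrow> 0 \<notin> set t \<Longrightarrow> 0 \<notin> set w"
  by (induction s t arbitrary: w rule: stuffle.induct) auto

section \<open>The shuffle relation\<close>

text \<open>Multiplicities matter here, so this is a list version of the set \<open>shuffles\<close>.\<close>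

fun shuffle :: "'a list \<Rightarrow> 'a list \<Rightarrow> 'a list list" where
  "shuffle (x # u) (y # v) = map ((#) x) (shuffle u (y # v)) @ map ((#) y) (shuffle (x # u) v)"
| "shuffle u v = [u @ v]"

lemma shuffle_Nil [simp]: "shuffle [] v = [v]" "shuffle u [] = [u]"
  by (cases u; simp)+

lemma mset_shuffle: "w \<in> set (shuffle u v) \<Longrightarrow> mset w = mset u + mset v"
  by (induction u v arbitrary: w rule: shuffle.induct) auto

text \<open>Only words ending in \<open>True\<close> have a polylogarithm that is a power series; the word \<open>[False]\<close> would stand
  for a logarithm.\<close>

definition admissible :: "bool list \<Rightarrow> bool" where
  "admissible w \<longleftrightarrow> w = [] \<or> last w"

lemma admissible_Cons: "admissible (x # w) \<longleftrightarrow> admissible w \<and> (x \<or> w \<noteq> [])"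
  by (auto simp: admissible_def)

lemma admissible_shuffle:
  "w \<in> set (shuffle u v) \<Longrightarrow> admissible u \<Longrightarrow> admissible v \<Longrightarrow> admissible w"
proof (induction u v arbitrary: w rule: shuffle.induct)
  case (1 x u y v)
  have ne: "w' \<noteq> []" if "w' \<in> set (shuffle u (y # v)) \<union> set (shuffle (x # u) v)" for w'
    using that mset_shuffle by fastforce
  then show ?case using 1 by (auto simp: admissible_Cons)
qed auto

text \<open>Iterated integrals as power series: the letter \<open>False\<close> stands for integration against \<open>dt/t\<close> and
  \<open>True\<close> for integration against \<open>dt/(1 - t)\<close>. Division by \<open>0\<close> makes the constant term vanish.\<close>

primrec polylog :: "bool list \<Rightarrow> rat fps" where
  "polylog [] = 1"
| "polylog (x # w) = Abs_fps (\<lambda>n. (if x then \<Sum>m<n. polylog w $ m else polylog w $ n) / of_nat n)"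

text \<open>The Euler operator \<open>t d/dt\<close>. It is a derivation and determines a power series up to the constant term,
  which is how the product formula for polylogarithms is proved.\<close>

definition theta :: "rat fps \<Rightarrow> rat fps" where
  "theta f = fps_X * fps_deriv f"

lemma theta_nth: "theta f $ n = of_nat n * f $ n"
  by (cases n) (auto simp: theta_def)

lemma theta_mult: "theta (f * g) = theta f * g + f * theta g"
  by (simp add: theta_def algebra_simps)

lemma theta_add: "theta (f + g) = theta f + theta g"
  by (simp add: theta_def algebra_simps)

lemma theta_inject:
  assumes "theta f = theta g" "f $ 0 = g $ 0"
  shows "f = g"
proof (rule fps_ext)
  fix n
  have "of_nat n * f $ n = of_nat n * g $ n" using assms(1) by (metis theta_nth)
  then show "f $ n = g $ n" using assms(2) by (cases "n = 0") auto
qed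

text \<open>The factor \<open>t/(1 - t)\<close> or \<open>1\<close> by which the Euler operator takes off the first letter.\<close>

definition geometric_tail :: "bool \<Rightarrow> rat fps" where
  "geometric_tail x = (if x then Abs_fps (\<lambda>n. if n = 0 then 0 else 1) else 1)"

lemma polylog_nth_0: "w \<noteq> [] \<Longrightarrow> polylog w $ 0 = 0"
  by (cases w) auto

lemma theta_polylog_Cons:
  assumes "admissible (x # w)"
  shows "theta (polylog (x # w)) = geometric_tail x * polylog w"
proof (rule fps_ext)
  fix n
  show "theta (polylog (x # w)) $ n = (geometric_tail x * polylog w) $ n"
  proof (cases x)
    case True
    have "(geometric_tail x * polylog w) $ n = (\<Sum>i=0..n. if i = n then 0 else polylog w $ i)"
      unfolding mult.commute[of "geometric_tail x"] fps_mult_nth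
      using True by (intro sum.cong) (auto simp: geometric_tail_def)
    also have "\<dots> = (\<Sum>m<n. polylog w $ m)"
      by (rule sum.mono_neutral_cong_right) auto
    finally show ?thesis using True by (simp add: theta_nth)
  next
    case False
    then have "w \<noteq> []" using assms by (auto simp: admissible_Cons)
    then show ?thesis using False polylog_nth_0[of w]
      by (auto simp: theta_nth geometric_tail_def)
  qed
qed

lemma sum_list_fps_mult_left: "(\<Sum>w\<leftarrow>L. g * f w) = g * (\<Sum>w\<leftarrow>L. f w :: rat fps)"
  by (induction L) (auto simp: algebra_simps)

lemma theta_sum_list: "theta (\<Sum>w\<leftarrow>L. f w) = (\<Sum>w\<leftarrow>L. theta (f w))"
  by (induction L) (auto simp: theta_def algebra_simps)

text \<open>The product rule for the Euler operator takes the first letter off either factor, exactly as the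
  recursion for shuffles does.\<close>

lemma polylog_mult:
  "admissible u \<Longrightarrow> admissible v \<Longrightarrow>
   polylog u * polylog v = (\<Sum>w\<leftarrow>shuffle u v. polylog w)"
proof (induction u v rule: shuffle.induct)
  case (1 x u y v)
  note adm = 1(3,4)
  have adm': "admissible u" "admissible v" using adm by (auto simp: admissible_Cons)
  show ?case
  proof (rule theta_inject)
    have x: "(\<Sum>w\<leftarrow>shuffle u (y # v). theta (polylog (x # w))) =
      (\<Sum>w\<leftarrow>shuffle u (y # v). geometric_tail x * polylog w)"
    proof (intro arg_cong[of _ _ sum_list] map_cong refl theta_polylog_Cons)
      fix w assume w: "w \<in> set (shuffle u (y # v))"
      show "admissible (x # w)"
        using admissible_shuffle[OF w] mset_shuffle[OF w] adm adm'
        by (cases "w = []") (auto simp: admissible_Cons[of x])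
    qed
    have y: "(\<Sum>w\<leftarrow>shuffle (x # u) v. theta (polylog (y # w))) =
      (\<Sum>w\<leftarrow>shuffle (x # u) v. geometric_tail y * polylog w)"
    proof (intro arg_cong[of _ _ sum_list] map_cong refl theta_polylog_Cons)
      fix w assume w: "w \<in> set (shuffle (x # u) v)"
      show "admissible (y # w)"
        using admissible_shuffle[OF w] mset_shuffle[OF w] adm adm'
        by (cases "w = []") (auto simp: admissible_Cons[of y])
    qed
    have "theta (polylog (x # u) * polylog (y # v)) =
      geometric_tail x * (polylog u * polylog (y # v)) +
      geometric_tail y * (polylog (x # u) * polylog v)"
      unfolding theta_mult theta_polylog_Cons[OF adm(1)] theta_polylog_Cons[OF adm(2)]
      by (simp add: mult_ac del: polylog.simps)
    also have "\<dots> = theta (\<Sum>w\<leftarrow>shuffle (x # u) (y # v). polylog w)"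
      unfolding 1(1)[OF adm'(1) adm(2)] 1(2)[OF adm(1) adm'(2)] shuffle.simps map_append
        sum_list_append map_map theta_add
      by (simp add: theta_sum_list o_def x y sum_list_fps_mult_left del: polylog.simps)
    finally show "theta (polylog (x # u) * polylog (y # v)) =
      theta (\<Sum>w\<leftarrow>shuffle (x # u) (y # v). polylog w)" .
    have "(\<Sum>w\<leftarrow>map ((#) z) L. polylog w) $ 0 = 0" for z L
      by (induction L) auto
    then show "(polylog (x # u) * polylog (y # v)) $ 0 =
      (\<Sum>w\<leftarrow>shuffle (x # u) (y # v). polylog w) $ 0" by simp
  qed
qed auto

text \<open>An exponent \<open>a\<close> becomes \<open>a - 1\<close> letters \<open>False\<close> followed by one letter \<open>True\<close>. The first argument of
  \<open>composition\<close> counts the letters \<open>False\<close> read since the last \<open>True\<close>.\<close>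

primrec word :: "nat list \<Rightarrow> bool list" where
  "word [] = []"
| "word (a # s) = replicate (a - 1) False @ True # word s"

fun composition :: "nat \<Rightarrow> bool list \<Rightarrow> nat list" where
  "composition c [] = []"
| "composition c (x # w) = (if x then Suc c # composition 0 w else composition (Suc c) w)"

lemma admissible_word: "admissible (word s)"
  by (induction s) (auto simp: admissible_def)

lemma word_composition:
  "admissible w \<Longrightarrow> w \<noteq> [] \<Longrightarrow> word (composition c w) = replicate c False @ w"
proof (induction w arbitrary: c)
  case (Cons x w)
  have "admissible w" and "x \<or> w \<noteq> []"
    using Cons.prems by (auto simp: admissible_Cons)
  then show ?case
    using Cons.IH[of 0] Cons.IH[of "Suc c"]
    by (cases "w = []") (auto simp: replicate_app_Cons_same)
qed simp

lemma word_composition_0: "admissible w \<Longrightarrow> word (composition 0 w) = w"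
  by (cases "w = []") (auto simp: word_composition)

lemma composition_pos: "0 \<notin> set (composition c w)"
  by (induction w arbitrary: c) auto

lemma length_word: "0 \<notin> set s \<Longrightarrow> length (word s) = sum_list s"
  by (induction s) auto

lemma polylog_replicate:
  "polylog (replicate c False @ w) $ n = polylog w $ n / of_nat n ^ c" if "w \<noteq> []"
  using that by (induction c) auto

text \<open>The coefficients of a polylogarithm are the summands of a harmonic sum over its largest index, so the
  partial sums of the coefficients are harmonic sums.\<close>

lemma polylog_word:
  assumes "0 \<notin> set s"
  shows "0 < n \<Longrightarrow> (\<Sum>m<n. polylog (word s) $ m) = H s (n - 1)"
    and "s = a # t \<Longrightarrow> polylog (word s) $ m = H t (m - 1) / of_nat m ^ a"
proof -
  have "(0 < n \<longrightarrow> (\<Sum>m<n. polylog (word s) $ m) = H s (n - 1)) \<and>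
        (\<forall>a t m. s = a # t \<longrightarrow> polylog (word s) $ m = H t (m - 1) / of_nat m ^ a)" for n
    using assms
  proof (induction s arbitrary: n)
    case Nil
    have "(\<Sum>m<n. (1 :: rat fps) $ m) = 1" if "0 < n"
      using that by (simp add: sum.delta)
    then show ?case by simp
  next
    case (Cons b s)
    obtain c where c: "b = Suc c" using Cons.prems by (cases b) auto
    have *: "polylog (word (b # s)) $ m = H s (m - 1) / of_nat m ^ b" for m
      using Cons.IH[of m] Cons.prems unfolding c
      by (cases "m = 0") (auto simp: polylog_replicate)
    have "(\<Sum>m<n. H s (m - 1) / of_nat m ^ b) = (\<Sum>m=1..n - 1. H s (m - 1) / of_nat m ^ b)"
      if "0 < n"
      by (rule sum.mono_neutral_right) (use that c in auto)
    then show ?case using * by simp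
  qed
  then show "0 < n \<Longrightarrow> (\<Sum>m<n. polylog (word s) $ m) = H s (n - 1)"
    and "s = a # t \<Longrightarrow> polylog (word s) $ m = H t (m - 1) / of_nat m ^ a" by blast+
qed

text \<open>A chain of indices is cut at the position of \<open>a\<close>: below the index \<open>k\<close> there lies a chain for \<open>s\<close>,
  above it a chain for \<open>t\<close> with its smallest index at the head.\<close>

lemma H_H_asc: "(\<Sum>k=1..n. H s (k - 1) / of_nat k ^ a * H_asc n t k) = H (rev t @ a # s) n"
proof (induction t arbitrary: s a)
  case (Cons b t)
  have "(\<Sum>k=1..n. H s (k - 1) / of_nat k ^ a * H_asc n (b # t) k) =
    (\<Sum>k=1..n. \<Sum>j=1..n. if k < j then H s (k - 1) / of_nat k ^ a * (H_asc n t j / of_nat j ^ b) else 0)"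
  proof (intro sum.cong refl)
    fix k assume "k \<in> {1..n}"
    have "H_asc n (b # t) k = (\<Sum>j=1..n. if k < j then H_asc n t j / of_nat j ^ b else 0)"
      unfolding H_asc.simps by (rule sum.mono_neutral_cong_left) auto
    then show "H s (k - 1) / of_nat k ^ a * H_asc n (b # t) k =
      (\<Sum>j=1..n. if k < j then H s (k - 1) / of_nat k ^ a * (H_asc n t j / of_nat j ^ b) else 0)"
      by (auto simp: sum_distrib_left intro!: sum.cong)
  qed
  also have "\<dots> = (\<Sum>j=1..n. \<Sum>k=1..n. if k < j then H s (k - 1) / of_nat k ^ a * (H_asc n t j / of_nat j ^ b) else 0)"
    by (rule sum.swap)
  also have "\<dots> = (\<Sum>j=1..n. H (a # s) (j - 1) / of_nat j ^ b * H_asc n t j)"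
  proof (intro sum.cong refl)
    fix j assume "j \<in> {1..n}"
    then have "H (a # s) (j - 1) = (\<Sum>k=1..n. if k < j then H s (k - 1) / of_nat k ^ a else 0)"
      unfolding H.simps by (intro sum.mono_neutral_cong_left) auto
    then show "(\<Sum>k=1..n. if k < j then H s (k - 1) / of_nat k ^ a * (H_asc n t j / of_nat j ^ b) else 0) =
      H (a # s) (j - 1) / of_nat j ^ b * H_asc n t j"
      by (simp only: sum_distrib_right sum_divide_distrib) (auto intro!: sum.cong)
  qed
  also have "\<dots> = H (rev t @ b # a # s) n" by (rule Cons.IH)
  finally show ?case by simp
qed simp

lemma H_asc_0: "H_asc n t 0 = H (rev t) n"
proof (cases t)
  case (Cons b t)
  then show ?thesis using H_H_asc[where s = "[]" and a = b and t = t and n = n]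
    by (simp add: mult.commute)
qed simp

lemma polylog_word_H_asc:
  assumes "0 \<notin> set s"
  shows "(\<Sum>m\<le>n. polylog (word s) $ m * H_asc n t m) = H (rev t @ s) n"
proof (cases s)
  case Nil
  have "(\<Sum>m\<le>n. (1 :: rat fps) $ m * H_asc n t m) = (\<Sum>m\<le>n. if m = 0 then H_asc n t m else 0)"
    by (intro sum.cong) auto
  then show ?thesis using Nil by (simp add: H_asc_0)
next
  case (Cons a s')
  have "(\<Sum>m\<le>n. polylog (word s) $ m * H_asc n t m) =
    (\<Sum>m=1..n. H s' (m - 1) / of_nat m ^ a * H_asc n t m)"
    by (rule sum.mono_neutral_cong_right)
       (use polylog_word(2)[OF assms Cons] assms Cons in \<open>auto simp del: One_nat_def\<close>)
  then show ?thesis using H_H_asc Cons by simp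
qed

lemma sum_sum_list_nth:
  "(\<Sum>w\<leftarrow>L. \<Sum>N<n. f w $ N) = (\<Sum>N<n. (\<Sum>w\<leftarrow>L. f w :: rat fps) $ N)"
  by (induction L) (auto simp: sum.distrib)

text \<open>The coefficients of \<open>polylog (word s) * polylog (word t)\<close> are added up to degree \<open>p - 1\<close>. Expanding the
  product by shuffles gives the left-hand side. Expanding it as a Cauchy product gives a sum over
  \<open>m + n < p\<close>, and reflecting the indices of the second factor turns the condition \<open>n < p - m\<close> into
  \<open>m < p - n\<close>: the two chains join to a single one.\<close>

theorem shuffle_relation:
  assumes p: "prime p" and pos: "0 \<notin> set s" "0 \<notin> set t"
  shows "rat_cong (\<Sum>w\<leftarrow>shuffle (word s) (word t). H (composition 0 w) (p - 1))
           ((-1) ^ sum_list t * H (rev t @ s) (p - 1)) p"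
proof -
  have p0: "0 < p" using p by (rule prime_gt_0_nat)
  have "(\<Sum>w\<leftarrow>shuffle (word s) (word t). H (composition 0 w) (p - 1)) =
    (\<Sum>w\<leftarrow>shuffle (word s) (word t). \<Sum>N<p. polylog w $ N)"
  proof (intro arg_cong[of _ _ sum_list] map_cong refl)
    fix w assume "w \<in> set (shuffle (word s) (word t))"
    then have "admissible w" using admissible_shuffle admissible_word by blast
    then show "H (composition 0 w) (p - 1) = (\<Sum>N<p. polylog w $ N)"
      using polylog_word(1)[OF composition_pos p0, of 0 w] word_composition_0 by simp
  qed
  also have "\<dots> = (\<Sum>N<p. (\<Sum>w\<leftarrow>shuffle (word s) (word t). polylog w) $ N)"
    by (rule sum_sum_list_nth)
  also have "(\<Sum>w\<leftarrow>shuffle (word s) (word t). polylog w) = polylog (word s) * polylog (word t)"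
    by (simp add: polylog_mult admissible_word)
  also have "(\<Sum>N<p. (polylog (word s) * polylog (word t)) $ N) =
    (\<Sum>N<p. \<Sum>m\<le>N. polylog (word s) $ m * polylog (word t) $ (N - m))"
    by (simp add: fps_mult_nth atLeast0AtMost)
  also have "\<dots> = (\<Sum>m<p. \<Sum>n<p - m. polylog (word s) $ m * polylog (word t) $ n)"
    unfolding sum.Sigma[of "{..<p}" "\<lambda>N. {..N}", simplified] sum.Sigma[of "{..<p}" "\<lambda>m. {..<p - m}", simplified]
    by (rule sum.reindex_bij_witness[of _ "\<lambda>(m, n). (m + n, m)" "\<lambda>(N, m). (m, N - m)"]) auto
  also have "\<dots> = (\<Sum>m\<le>p - 1. polylog (word s) $ m * H t (p - 1 - m))"
  proof (rule sum.cong)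
    fix m assume "m \<in> {..p - 1}"
    then have "0 < p - m" using p0 by auto
    from polylog_word(1)[OF pos(2) this]
    show "(\<Sum>n<p - m. polylog (word s) $ m * polylog (word t) $ n) =
      polylog (word s) $ m * H t (p - 1 - m)"
      by (simp add: sum_distrib_left[symmetric] diff_commute)
  qed (use p0 in auto)
  also have "rat_cong \<dots> (\<Sum>m\<le>p - 1. polylog (word s) $ m * ((-1) ^ sum_list t * H_asc (p - 1) t m)) p"
  proof (intro rat_cong_sum rat_cong_mult_left p H_reflect)
    fix m assume m: "m \<in> {..p - 1}"
    then show "m < p" using p0 by auto
    show "p_integral p (polylog (word s) $ m)"
    proof (cases s)
      case (Cons a s')
      show ?thesis
      proof (cases "m = 0")
        case False
        then show ?thesis unfolding polylog_word(2)[OF pos(1) Cons]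
          using m p p0 by (intro p_integral_divide_power p_integral_H) auto
      qed (use polylog_word(2)[OF pos(1) Cons, of 0] Cons pos(1) p in \<open>simp add: zero_power\<close>)
    qed (use p in \<open>auto simp: fps_one_nth\<close>)
  qed
  also have "(\<Sum>m\<le>p - 1. polylog (word s) $ m * ((-1) ^ sum_list t * H_asc (p - 1) t m)) =
    (-1) ^ sum_list t * (\<Sum>m\<le>p - 1. polylog (word s) $ m * H_asc (p - 1) t m)"
    by (simp add: sum_distrib_left mult_ac)
  finally show ?thesis using p by (simp add: polylog_word_H_asc[OF pos(1)])
qed

section \<open>Duality\<close>

text \<open>A sum \<open>S\<close> arises from the constant sequence by two operators: dividing by the index (\<open>False\<close>), and
  dividing by the index and then forming partial sums (\<open>True\<close>). All sequences are made to vanish at \<open>0\<close>,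
  which is what makes the binomial transform exchange the two operators.\<close>

primrec star_sum :: "bool list \<Rightarrow> nat \<Rightarrow> rat" where
  "star_sum [] = (\<lambda>n. if n = 0 then 0 else 1)"
| "star_sum (x # w) =
     (\<lambda>n. if x then \<Sum>k=1..n. star_sum w k / of_nat k else star_sum w n / of_nat n)"

primrec star_word :: "nat list \<Rightarrow> bool list" where
  "star_word [] = []"
| "star_word (a # s) = True # replicate (a - 1) False @ star_word s"

lemma star_sum_0 [simp]: "star_sum w 0 = 0"
  by (cases w) auto

lemma star_sum_replicate:
  "star_sum (replicate c False @ w) n = star_sum w n / of_nat n ^ c"
  by (induction c) auto

lemma S_eq_star_sum:
  "0 \<notin> set s \<Longrightarrow> 0 < n \<Longrightarrow> S s n = star_sum (star_word s) n"
proof (induction s arbitrary: n)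
  case (Cons a s)
  then obtain c where c: "a = Suc c" by (cases a) auto
  then show ?case using Cons
    by (auto simp: star_sum_replicate intro!: sum.cong)
qed simp

lemma p_integral_star_sum: "prime p \<Longrightarrow> n < p \<Longrightarrow> p_integral p (star_sum w n)"
proof (induction w arbitrary: n)
  case (Cons x w)
  have "p_integral p (star_sum w k / of_nat k)" if "k \<le> n" for k
    using Cons that by (cases "k = 0") (auto intro: p_integral_divide_lt)
  then show ?case using Cons.prems by (auto intro!: p_integral_sum)
qed auto

text \<open>Every word starting with \<open>True\<close> encodes a list of exponents. The prefix of length \<open>c\<close> is the
  generalisation needed to read the word from left to right.\<close>

lemma star_word_surj:
  "\<exists>s. 0 \<notin> set s \<and> star_word s = True # replicate c False @ w \<and> length s = Suc (length (filter id w))"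
proof (induction w arbitrary: c)
  case Nil
  show ?case by (rule exI[of _ "[Suc c]"]) auto
next
  case (Cons x w)
  show ?case
  proof (cases x)
    case True
    obtain s where "0 \<notin> set s" "star_word s = True # replicate 0 False @ w"
      "length s = Suc (length (filter id w))" using Cons by blast
    then show ?thesis using True by (intro exI[of _ "Suc c # s"]) (auto simp: id_def)
  next
    case False
    then show ?thesis using Cons[of "Suc c"] by (simp add: replicate_app_Cons_same)
  qed
qed

lemma length_star_word: "0 \<notin> set s \<Longrightarrow> length (star_word s) = sum_list s"
  by (induction s) auto

lemma count_star_word: "length (filter id (star_word s)) = length s"
  by (induction s) (auto simp: filter_replicate)

definition binomial_transform :: "(nat \<Rightarrow> rat) \<Rightarrow> nat \<Rightarrow> rat" where
  "binomial_transform f n = (\<Sum>k\<le>n. (-1) ^ k * of_nat (n choose k) * f k)"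

lemma binomial_Suc_div:
  "of_nat (n choose k) / of_nat (Suc k) = (of_nat (Suc n choose Suc k) / of_nat (Suc n) :: rat)"
proof -
  have "of_nat (Suc k) * of_nat (Suc n choose Suc k) = (of_nat (Suc n) * of_nat (n choose k) :: rat)"
    by (simp only: Suc_times_binomial flip: of_nat_mult)
  then show ?thesis by (simp add: frac_eq_eq mult.commute del: of_nat_Suc binomial_Suc_Suc)
qed

lemma binomial_transform_Suc:
  assumes "f 0 = 0"
  shows "binomial_transform f (Suc n) =
    (\<Sum>k\<le>n. (-1) ^ Suc k * of_nat (Suc n choose Suc k) * f (Suc k))"
  using assms unfolding binomial_transform_def sum.atMost_Suc_shift by simp

lemma binomial_transform_pascal:
  "binomial_transform g (Suc n) =
   binomial_transform g n - (\<Sum>k\<le>n. (-1) ^ k * of_nat (n choose k) * g (Suc k))"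
proof -
  have "binomial_transform g n = (\<Sum>k\<le>Suc n. (-1) ^ k * of_nat (n choose k) * g k)"
    by (simp add: binomial_transform_def binomial_eq_0)
  also have "\<dots> = g 0 + (\<Sum>k\<le>n. (-1) ^ Suc k * of_nat (n choose Suc k) * g (Suc k))"
    unfolding sum.atMost_Suc_shift by simp
  finally have "binomial_transform g n =
    g 0 + (\<Sum>k\<le>n. (-1) ^ Suc k * of_nat (n choose Suc k) * g (Suc k))" .
  moreover have "binomial_transform g (Suc n) =
    g 0 + (\<Sum>k\<le>n. (-1) ^ Suc k * of_nat (Suc n choose Suc k) * g (Suc k))"
    unfolding binomial_transform_def sum.atMost_Suc_shift by simp
  moreover have "(\<Sum>k\<le>n. (-1) ^ Suc k * of_nat (Suc n choose Suc k) * g (Suc k)) =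
    (\<Sum>k\<le>n. (-1) ^ Suc k * of_nat (n choose Suc k) * g (Suc k)) -
    (\<Sum>k\<le>n. (-1) ^ k * of_nat (n choose k) * g (Suc k))"
    unfolding sum_subtractf[symmetric] by (intro sum.cong) (auto simp: algebra_simps)
  ultimately show ?thesis by simp
qed

lemma binomial_transform_absorb:
  assumes "f 0 = 0"
  shows "(\<Sum>k\<le>n. (-1) ^ k * of_nat (n choose k) * (f (Suc k) / of_nat (Suc k))) =
    - binomial_transform f (Suc n) / of_nat (Suc n)"
proof -
  have "(\<Sum>k\<le>n. (-1) ^ k * of_nat (n choose k) * (f (Suc k) / of_nat (Suc k))) =
    (\<Sum>k\<le>n. (-1) ^ k * (of_nat (n choose k) / of_nat (Suc k)) * f (Suc k))"
    by (intro sum.cong) auto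
  also have "\<dots> = - binomial_transform f (Suc n) / of_nat (Suc n)"
    unfolding binomial_Suc_div binomial_transform_Suc[where f = f, OF assms] sum_divide_distrib
      sum_negf[symmetric]
    by (intro sum.cong) (auto simp del: binomial_Suc_Suc of_nat_Suc)
  finally show ?thesis .
qed

text \<open>The next two lemmas say that the transform exchanges the two operators behind \<open>star_sum\<close>; both come
  from Pascal's rule and \<open>binomial_transform_absorb\<close>.\<close>

lemma binomial_transform_divide:
  assumes "f 0 = 0"
  shows "binomial_transform (\<lambda>k. f k / of_nat k) n = (\<Sum>m=1..n. binomial_transform f m / of_nat m)"
proof (induction n)
  case 0
  show ?case by (simp add: binomial_transform_def)
next
  case (Suc n)
  show ?case
    unfolding binomial_transform_pascal[of "\<lambda>k. f k / of_nat k"] binomial_transform_absorb[of f, OF assms] Suc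
    by simp
qed

lemma binomial_transform_sum:
  assumes "f 0 = 0"
  shows "binomial_transform (\<lambda>n. \<Sum>k=1..n. f k / of_nat k) n = binomial_transform f n / of_nat n"
proof (cases n)
  case 0
  then show ?thesis by (simp add: binomial_transform_def)
next
  case (Suc m)
  let ?g = "\<lambda>n. \<Sum>k=1..n. f k / of_nat k"
  have "binomial_transform ?g (Suc m) =
    - (\<Sum>k\<le>m. (-1) ^ k * of_nat (m choose k) * (f (Suc k) / of_nat (Suc k)))"
    unfolding binomial_transform_pascal[of ?g] unfolding binomial_transform_def
      sum_subtractf[symmetric] sum_negf[symmetric]
    by (intro sum.cong) (auto simp: algebra_simps)
  then show ?thesis using binomial_transform_absorb[of f m, OF assms] Suc by simp
qed

text \<open>The transform of the constant sequence, cut off at \<open>0\<close>, is its negative; this is where the sign comes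
  from.\<close>

lemma binomial_transform_star_sum:
  "binomial_transform (star_sum w) n = - star_sum (map Not w) n"
proof (induction w arbitrary: n)
  case Nil
  show ?case
  proof (cases "n = 0")
    case False
    have "0 = (\<Sum>k\<le>n. (-1) ^ k * of_nat (n choose k) :: rat)"
      using choose_alternating_sum[of n] False by simp
    also have "\<dots> = (\<Sum>k\<in>insert 0 {1..n}. (-1) ^ k * of_nat (n choose k))"
      by (intro sum.cong) auto
    also have "\<dots> = 1 + (\<Sum>k=1..n. (-1) ^ k * of_nat (n choose k))"
      by simp
    finally have "(\<Sum>k=1..n. (-1) ^ k * of_nat (n choose k)) = (-1 :: rat)" by linarith
    moreover have "binomial_transform (star_sum []) n = (\<Sum>k=1..n. (-1) ^ k * of_nat (n choose k))"
      unfolding binomial_transform_def by (rule sum.mono_neutral_cong_right) auto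
    ultimately show ?thesis using False by simp
  qed (simp add: binomial_transform_def)
next
  case (Cons x w)
  then show ?case
    using binomial_transform_sum[of "star_sum w" n] binomial_transform_divide[of "star_sum w" n]
    by (simp add: sum_negf)
qed

lemma rat_cong_binomial_pred:
  assumes "prime p" "k < p"
  shows "rat_cong ((-1) ^ k * of_nat ((p - 1) choose k)) 1 p"
  using assms(2)
proof (induction k)
  case (Suc k)
  obtain q where q: "p = Suc q" using assms(1) prime_gt_0_nat gr0_conv_Suc by blast
  have "p dvd (p choose Suc k)" using Suc.prems assms(1) by (intro dvd_choose_prime) auto
  then obtain c where "p choose Suc k = p * c" by blast
  then have "p * c = (q choose k) + (q choose Suc k)" using q by simp
  then have "of_nat (p * c) = (of_nat ((q choose k) + (q choose Suc k)) :: rat)" by (rule arg_cong)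
  then have c: "of_nat (q choose Suc k) = (of_nat p * of_nat c - of_nat (q choose k) :: rat)"
    by (simp del: binomial_Suc_Suc)
  have eq: "(-1) ^ Suc k * of_nat (q choose Suc k) =
      of_nat p * ((-1) ^ Suc k * of_nat c) + (-1) ^ k * (of_nat (q choose k) :: rat)"
    unfolding c by (simp add: algebra_simps)
  have "rat_cong (of_nat p * ((-1) ^ Suc k * of_nat c) + (-1) ^ k * of_nat (q choose k)) (0 + 1) p"
    using Suc assms(1) q
    by (intro rat_cong_add rat_cong_p_0 p_integral_mult p_integral_minus_one_power) auto
  then show ?case using q eq by simp
qed simp

text \<open>At \<open>p - 1\<close> the coefficients \<open>(-1)\<^sup>k (p - 1 choose k)\<close> of the binomial transform are congruent to 1, so
  the transform is the plain partial sum, and this is again a sum \<open>S\<close>: the last partial summation is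
  the leading letter \<open>True\<close> of its word. The dual exponents come from exchanging all other letters. A
  word of length \<open>w\<close> with leading \<open>True\<close> has as many letters \<open>True\<close> as there are exponents, which gives
  the relation between the depths.\<close>

theorem duality:
  assumes s: "0 \<notin> set s" "s \<noteq> []"
  obtains t where "0 \<notin> set t" "t \<noteq> []" "sum_list t = sum_list s"
    "length s + length t = sum_list s + 1"
    "\<And>p. prime p \<Longrightarrow> rat_cong (S s (p - 1)) (- S t (p - 1)) p"
proof -
  obtain w where w: "star_word s = True # w" using s by (cases s) auto
  obtain t where t: "0 \<notin> set t" "star_word t = True # map Not w"
    "length t = Suc (length (filter id (map Not w)))"
    using star_word_surj[of 0 "map Not w"] by auto
  have len: "length w + 1 = sum_list s" using length_star_word[OF s(1)] w by simp
  have st: "sum_list t = sum_list s" using length_star_word[OF t(1)] t len by simp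
  have "length s = Suc (length (filter id w))" using count_star_word[of s] w by simp
  moreover have "length (filter id (map Not w)) + length (filter id w) = length w"
    by (induction w) auto
  ultimately have lst: "length s + length t = sum_list s + 1" using t len by simp
  have "rat_cong (S s (p - 1)) (- S t (p - 1)) p" if p: "prime p" for p
  proof -
    have p1: "0 < p - 1" using prime_gt_1_nat[OF p] by simp
    have "S s (p - 1) = (\<Sum>k=1..p - 1. star_sum (False # w) k)"
      using S_eq_star_sum[OF s(1) p1] w by simp
    also have "\<dots> = (\<Sum>k\<le>p - 1. 1 * star_sum (False # w) k)"
      by (rule sum.mono_neutral_cong_left) auto
    also have "rat_cong \<dots> (\<Sum>k\<le>p - 1. (-1) ^ k * of_nat ((p - 1) choose k) * star_sum (False # w) k) p"
    proof (intro rat_cong_sum rat_cong_mult_right p)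
      fix k assume "k \<in> {..p - 1}"
      then have k: "k < p" using p1 by auto
      show "p_integral p (star_sum (False # w) k)" using p k by (rule p_integral_star_sum)
      show "rat_cong 1 ((-1) ^ k * of_nat ((p - 1) choose k)) p"
        using rat_cong_sym rat_cong_binomial_pred p k by blast
    qed
    also have "(\<Sum>k\<le>p - 1. (-1) ^ k * of_nat ((p - 1) choose k) * star_sum (False # w) k) =
      binomial_transform (star_sum (False # w)) (p - 1)"
      by (simp add: binomial_transform_def)
    also have "\<dots> = - S t (p - 1)"
      unfolding binomial_transform_star_sum S_eq_star_sum[OF t(1) p1] t(2) by simp
    finally show ?thesis .
  qed
  then show ?thesis using that t st lst by (metis One_nat_def list.size(3) nat.simps(3))
qed

section \<open>Bernoulli numbers and sums of depth one and two\<close>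

text \<open>Comparing coefficients in \<open>B(x) (exp (n x) - 1) = x (1 + exp x + \<dots> + exp ((n - 1) x))\<close>, where \<open>B(x)\<close>
  is the generating function of the Bernoulli numbers.\<close>

theorem faulhaber:
  "of_nat (Suc m) * (\<Sum>j<n. of_nat j ^ m) =
   (\<Sum>i\<le>m. of_nat (Suc m choose i) * bernoulli i * of_nat n ^ (Suc m - i))"
proof -
  let ?B = "Abs_fps (\<lambda>k. bernoulli k / fact k)"
  have "fps_exp (of_nat n) - 1 = (fps_exp 1 - 1) * (\<Sum>j<n. fps_exp (of_nat j) :: rat fps)"
    using power_diff_1_eq[of "fps_exp (1 :: rat)" n] by (simp add: fps_exp_power_mult)
  then have "?B * (fps_exp (of_nat n) - 1) = fps_X * (\<Sum>j<n. fps_exp (of_nat j))"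
    by (simp only: bernoulli_generating_function flip: mult.assoc)
  then have "(?B * (fps_exp (of_nat n) - 1)) $ Suc m = (fps_X * (\<Sum>j<n. fps_exp (of_nat j))) $ Suc m"
    by simp
  also have "(?B * (fps_exp (of_nat n) - 1)) $ Suc m =
    (\<Sum>i\<le>m. bernoulli i / fact i * (of_nat n ^ (Suc m - i) / fact (Suc m - i)))"
    by (auto simp: fps_mult_nth atLeast0AtMost Suc_diff_le intro!: sum.cong)
  also have "(fps_X * (\<Sum>j<n. fps_exp (of_nat j :: rat))) $ Suc m = (\<Sum>j<n. of_nat j ^ m) / fact m"
    by (simp add: fps_sum_nth sum_divide_distrib)
  finally have "(\<Sum>j<n. of_nat j ^ m) / fact m * fact (Suc m) =
    (\<Sum>i\<le>m. bernoulli i / fact i * (of_nat n ^ (Suc m - i) / fact (Suc m - i))) * fact (Suc m)"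
    by simp
  also have "\<dots> = (\<Sum>i\<le>m. of_nat (Suc m choose i) * bernoulli i * of_nat n ^ (Suc m - i))"
    unfolding sum_distrib_right
    by (intro sum.cong) (auto simp: binomial_fact simp del: fact_Suc)
  also have "(\<Sum>j<n. of_nat j ^ m) / fact m * fact (Suc m) = of_nat (Suc m) * (\<Sum>j<n. of_nat j ^ m :: rat)"
    by simp
  finally show ?thesis .
qed

text \<open>Faulhaber's formula for \<open>n = 1\<close> is the usual recursion, in which \<open>B\<^sub>m\<close> has the coefficient \<open>m + 1 < p\<close>.\<close>

lemma p_integral_bernoulli:
  assumes "prime p"
  shows "Suc m < p \<Longrightarrow> p_integral p (bernoulli m)"
proof (induction m rule: less_induct)
  case (less m)
  define r where "r = (\<Sum>i<m. of_nat (Suc m choose i) * bernoulli i)"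
  have "p_integral p (of_nat (Suc m) * (\<Sum>j<1. of_nat j ^ m) - r)"
    unfolding r_def using less assms
    by (intro p_integral_diff p_integral_mult p_integral_sum) (auto simp del: of_nat_Suc)
  also have "of_nat (Suc m) * (\<Sum>j<1. of_nat j ^ m) - r = of_nat (Suc m) * bernoulli m"
    unfolding faulhaber r_def by (simp add: lessThan_Suc_atMost[symmetric] del: of_nat_Suc One_nat_def)
  finally have "p_integral p (of_nat (Suc m) * bernoulli m / of_nat (Suc m))"
    using less.prems assms by (intro p_integral_divide_lt) auto
  then show ?case by (simp del: of_nat_Suc)
qed

lemma sum_lessThan_pos_eq:
  "0 < e \<Longrightarrow> (\<Sum>j<n. of_nat j ^ e) = (\<Sum>j=1..n - 1. of_nat j ^ e :: rat)"
  by (rule sum.mono_neutral_right) auto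

text \<open>In Faulhaber's formula every summand carries a factor \<open>p\<close>.\<close>

lemma power_sum_cong_0:
  assumes "prime p" "0 < e" "Suc e < p"
  shows "rat_cong (\<Sum>k=1..p - 1. of_nat k ^ e) 0 p"
proof -
  define r where "r = (\<Sum>i\<le>e. of_nat (Suc e choose i) * bernoulli i * of_nat p ^ (e - i))"
  have "of_nat (Suc e) * (\<Sum>k<p. of_nat k ^ e) =
    (\<Sum>i\<le>e. of_nat (Suc e choose i) * bernoulli i * of_nat p ^ (Suc e - i))"
    by (rule faulhaber)
  also have "\<dots> = of_nat p * r"
    unfolding r_def sum_distrib_left by (intro sum.cong) (auto simp: Suc_diff_le)
  finally have "of_nat (Suc e) * (\<Sum>k<p. of_nat k ^ e) = of_nat p * r" .
  then have "(\<Sum>k<p. of_nat k ^ e) = of_nat p * (r / of_nat (Suc e))"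
    by (simp add: field_simps del: of_nat_Suc)
  moreover have "p_integral p (r / of_nat (Suc e))"
    unfolding r_def using assms
    by (intro p_integral_divide_lt p_integral_sum p_integral_mult p_integral_bernoulli) auto
  ultimately have "rat_cong (\<Sum>k<p. of_nat k ^ e) 0 p"
    using rat_cong_p_0 assms(1) by metis
  then show ?thesis using assms by (simp add: sum_lessThan_pos_eq)
qed

lemma rat_cong_fermat:
  assumes "prime p" "0 < k" "k < p" "b \<le> p - 1"
  shows "rat_cong (1 / of_nat k ^ b) (of_nat k ^ (p - 1 - b)) p"
proof -
  have "\<not> p dvd k" using assms by (auto dest: dvd_imp_le)
  then have "[k ^ (p - 1) = 1] (mod p)" using assms by (intro fermat_theorem)
  then have "[int (k ^ (p - 1)) = int 1] (mod int p)" by (simp only: cong_int_iff)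
  then have "rat_cong (of_int (int (k ^ (p - 1)))) (of_int (int 1)) p"
    using assms by (intro rat_cong_of_int)
  then have "rat_cong (of_nat k ^ (p - 1)) 1 p" by simp
  then have "rat_cong (1 / of_nat k ^ b * of_nat k ^ (p - 1)) (1 / of_nat k ^ b * 1) p"
    using assms by (intro rat_cong_mult_left p_integral_divide_power) auto
  moreover have "1 / of_nat k ^ b * of_nat k ^ (p - 1) = (of_nat k ^ (p - 1 - b) :: rat)"
    using assms by (simp add: power_diff)
  ultimately show ?thesis using assms rat_cong_sym by simp
qed

lemma H_depth_1:
  assumes "prime p" "0 < a" "Suc a < p"
  shows "rat_cong (H [a] (p - 1)) 0 p"
proof -
  have "rat_cong (H [a] (p - 1)) (\<Sum>k=1..p - 1. of_nat k ^ (p - 1 - a)) p"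
    unfolding H.simps using assms by (intro rat_cong_sum rat_cong_fermat) auto
  also have "rat_cong (\<Sum>k=1..p - 1. of_nat k ^ (p - 1 - a)) 0 p"
    using assms by (intro power_sum_cong_0) auto
  finally show ?thesis using assms by simp
qed

text \<open>By Fermat the quotient is a power whose exponent is \<open>e - b\<close> modulo \<open>p - 1\<close>; in the given range it is
  divisible by \<open>p - 1\<close> only for \<open>e = b\<close>.\<close>

lemma power_ratio_sum:
  assumes "prime p" "0 < b" "Suc b < p" "e < p"
  shows "rat_cong (\<Sum>k=1..p - 1. of_nat k ^ e / of_nat k ^ b) (if e = b then -1 else 0) p"
proof -
  consider "e < b" | "e = b" | "e > b" by linarith
  then show ?thesis
  proof cases
    case 1
    have "(\<Sum>k=1..p - 1. of_nat k ^ e / of_nat k ^ b) = H [b - e] (p - 1)"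
      unfolding H.simps using 1 by (intro sum.cong) (auto simp: power_diff)
    then show ?thesis using 1 assms H_depth_1[of p "b - e"] by simp
  next
    case 2
    have "(\<Sum>k=1..p - 1. of_nat k ^ e / of_nat k ^ b) = (\<Sum>k=1..p - 1. (1 :: rat))"
      using 2 by (intro sum.cong) auto
    also have "\<dots> = of_nat p * 1 + (-1)" using prime_ge_1_nat[OF assms(1)] by (simp add: of_nat_diff)
    also have "rat_cong (of_nat p * 1 + (-1)) (0 + (-1)) p"
      using assms by (intro rat_cong_add rat_cong_p_0) auto
    finally show ?thesis using 2 by simp
  next
    case 3
    have "(\<Sum>k=1..p - 1. of_nat k ^ e / of_nat k ^ b) = (\<Sum>k=1..p - 1. (of_nat k ^ (e - b) :: rat))"
      using 3 by (intro sum.cong) (auto simp: power_diff)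
    then show ?thesis using 3 assms power_sum_cong_0[of p "e - b"] by simp
  qed
qed

lemma rat_cong_prod:
  assumes "prime p" "finite A"
    "\<And>i. i \<in> A \<Longrightarrow> p_integral p (g i)" "\<And>i. i \<in> A \<Longrightarrow> rat_cong (f i) (g i) p"
  shows "rat_cong (prod f A) (prod g A) p \<and> p_integral p (prod g A)"
  using assms(2,3,4)
proof (induction A rule: finite_induct)
  case (insert i A)
  have "p_integral p (prod f A)" using insert assms(1) rat_cong_p_integral by blast
  moreover have "p_integral p (f i)" using insert assms(1) rat_cong_p_integral by blast
  ultimately show ?case using insert assms(1) by (auto intro!: rat_cong_mult)
qed (use assms in auto)

text \<open>Modulo \<open>p\<close> the upper entry is \<open>- a - 1\<close>, and \<open>(- a - 1 choose c) = (-1)\<^sup>c (a + c choose c)\<close>.\<close>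

lemma rat_cong_binomial_reflect:
  assumes "prime p" "a < p" "c < p"
  shows "rat_cong (of_nat ((p - 1 - a) choose c)) ((-1) ^ c * of_nat ((a + c) choose c)) p"
proof -
  have nd: "\<not> p dvd fact c" using assms by (simp add: prime_dvd_fact_iff)
  have "rat_cong (of_nat (p - 1 - a) - of_nat i) (- of_nat (Suc a) - of_nat i) p" for i
  proof -
    have "rat_cong (of_nat p * 1 + (- of_nat (Suc a) - of_nat i)) (0 + (- of_nat (Suc a) - of_nat i)) p"
      using assms by (intro rat_cong_add rat_cong_p_0) auto
    moreover have "of_nat p * 1 + (- of_nat (Suc a) - of_nat i) = of_nat (p - 1 - a) - (of_nat i :: rat)"
      using assms by (simp add: of_nat_diff)
    ultimately show ?thesis by (simp only: add_0_left)
  qed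
  then have "rat_cong (\<Prod>i=0..<c. of_nat (p - 1 - a) - of_nat i) (\<Prod>i=0..<c. - of_nat (Suc a) - of_nat i) p"
    using assms rat_cong_prod[of p "{0..<c}" "\<lambda>i. - of_nat (Suc a) - of_nat i"]
    by (auto simp del: of_nat_Suc)
  then have "rat_cong (1 / of_nat (fact c) * (\<Prod>i=0..<c. of_nat (p - 1 - a) - of_nat i))
     (1 / of_nat (fact c) * (\<Prod>i=0..<c. - of_nat (Suc a) - of_nat i)) p"
    using assms nd by (intro rat_cong_mult_left p_integral_divide_of_nat) auto
  then have "rat_cong ((of_nat (p - 1 - a) :: rat) gchoose c) ((- of_nat (Suc a)) gchoose c) p"
    by (simp add: gbinomial_prod_rev)
  also have "((- of_nat (Suc a) :: rat) gchoose c) = (-1) ^ c * (of_nat (a + c) gchoose c)"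
    using gbinomial_minus[of "of_nat (Suc a) :: rat" c] by (simp add: algebra_simps)
  finally show ?thesis by (simp add: binomial_gbinomial)
qed

text \<open>By Fermat the inner sum is a power sum with exponent \<open>p - 1 - a\<close>, hence a polynomial in the outer index
  with Bernoulli numbers in its coefficients. By \<open>power_ratio_sum\<close> only its monomial of degree \<open>b\<close>
  survives the outer summation; the Bernoulli number there is \<open>B\<^sub>p\<^sub>-\<^sub>a\<^sub>-\<^sub>b\<close>.\<close>

theorem H_depth_2:
  assumes "prime p" "0 < a" "0 < b" "a + b < p"
  shows "rat_cong (H [b, a] (p - 1))
           ((-1) ^ b * of_nat ((a + b - 1) choose (b - 1)) / of_nat b * bernoulli (p - (a + b))) p"
proof -
  define m where "m = p - 1 - a"
  have m: "Suc m = p - a" "m < p" "0 < m" using assms by (auto simp: m_def)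
  define c where "c = (\<lambda>i. of_nat (Suc m choose i) * bernoulli i / of_nat (Suc m))"
  have c: "p_integral p (c i)" if "i \<le> m" for i
    unfolding c_def using that m assms
    by (intro p_integral_divide_lt p_integral_mult p_integral_bernoulli) auto
  have inner: "(\<Sum>j<k. of_nat j ^ m) = (\<Sum>i\<le>m. c i * of_nat k ^ (Suc m - i))" for k
    using faulhaber[of m k] unfolding c_def
    by (simp add: sum_divide_distrib[symmetric] field_simps del: of_nat_Suc)
  have "H [b, a] (p - 1) = (\<Sum>k=1..p - 1. (\<Sum>j=1..k - 1. 1 / of_nat j ^ a) * (1 / of_nat k ^ b))"
    by simp
  also have "rat_cong \<dots> (\<Sum>k=1..p - 1. (\<Sum>j=1..k - 1. of_nat j ^ m) * (1 / of_nat k ^ b)) p"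
  proof (intro rat_cong_sum rat_cong_mult_right)
    fix k j assume k: "k \<in> {1..p - 1}" and j: "j \<in> {1..k - 1}"
    show "rat_cong (1 / of_nat j ^ a) (of_nat j ^ m) p"
      unfolding m_def using assms k j by (intro rat_cong_fermat) auto
  next
    fix k assume "k \<in> {1..p - 1}"
    then show "p_integral p (1 / of_nat k ^ b)"
      using assms by (intro p_integral_divide_power) auto
  qed (use assms in auto)
  also have "(\<Sum>k=1..p - 1. (\<Sum>j=1..k - 1. of_nat j ^ m) * (1 / of_nat k ^ b)) =
    (\<Sum>k=1..p - 1. \<Sum>i\<le>m. c i * (of_nat k ^ (Suc m - i) / of_nat k ^ b))"
    unfolding sum_lessThan_pos_eq[OF m(3), symmetric] inner sum_distrib_right
    by (intro sum.cong) auto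
  also have "\<dots> = (\<Sum>i\<le>m. c i * (\<Sum>k=1..p - 1. of_nat k ^ (Suc m - i) / of_nat k ^ b))"
    by (subst sum.swap) (simp add: sum_distrib_left)
  finally have "rat_cong (H [b, a] (p - 1))
    (\<Sum>i\<le>m. c i * (\<Sum>k=1..p - 1. of_nat k ^ (Suc m - i) / of_nat k ^ b)) p" .
  also have "rat_cong (\<Sum>i\<le>m. c i * (\<Sum>k=1..p - 1. of_nat k ^ (Suc m - i) / of_nat k ^ b))
    (\<Sum>i\<le>m. c i * (if Suc m - i = b then -1 else 0)) p"
    using assms m by (intro rat_cong_sum rat_cong_mult_left power_ratio_sum c) auto
  also have "(\<Sum>i\<le>m. c i * (if Suc m - i = b then -1 else 0)) =
    (\<Sum>i\<le>m. if i = p - (a + b) then - c i else 0)"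
    using assms m by (intro sum.cong) auto
  also have "\<dots> = - c (p - (a + b))" using assms m by simp
  also have "c (p - (a + b)) = of_nat (m choose (b - 1)) / of_nat b * bernoulli (p - (a + b))"
  proof -
    obtain b' where b': "b = Suc b'" using assms by (cases b) auto
    have sym: "Suc m choose (p - (a + b)) = Suc m choose b"
      using binomial_symmetric[of b "Suc m"] m assms by (simp add: diff_diff_left)
    have absorb: "of_nat (Suc m choose b) / of_nat (Suc m) = (of_nat (m choose b') / of_nat b :: rat)"
      unfolding b' by (simp only: binomial_Suc_div)
    have "c (p - (a + b)) = of_nat (Suc m choose b) / of_nat (Suc m) * bernoulli (p - (a + b))"
      unfolding c_def sym by simp
    then show ?thesis unfolding absorb by (simp add: b')
  qed
  finally have "rat_cong (H [b, a] (p - 1))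
    (- (of_nat (m choose (b - 1)) / of_nat b * bernoulli (p - (a + b)))) p"
    using assms by simp
  also have "- (of_nat (m choose (b - 1)) / of_nat b * bernoulli (p - (a + b))) =
    - (bernoulli (p - (a + b)) / of_nat b) * of_nat (m choose (b - 1))" by simp
  also have "rat_cong \<dots> (- (bernoulli (p - (a + b)) / of_nat b) *
    ((-1) ^ (b - 1) * of_nat ((a + (b - 1)) choose (b - 1)))) p"
    unfolding m_def using assms
    by (intro rat_cong_mult_left rat_cong_binomial_reflect p_integral_minus p_integral_divide_lt
         p_integral_bernoulli) auto
  also have "- (bernoulli (p - (a + b)) / of_nat b) *
      ((-1) ^ (b - 1) * of_nat ((a + (b - 1)) choose (b - 1))) =
    (-1) ^ b * of_nat ((a + b - 1) choose (b - 1)) / of_nat b * bernoulli (p - (a + b))"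
    using assms by (cases b) auto
  finally show ?thesis using assms by simp
qed

section \<open>Combinations with smooth denominators\<close>

definition smooth :: "nat \<Rightarrow> int \<Rightarrow> bool" where
  "smooth N b \<longleftrightarrow> b \<noteq> 0 \<and> (\<forall>q. prime q \<longrightarrow> int q dvd b \<longrightarrow> q \<le> N)"

lemma smooth_mult: "smooth N a \<Longrightarrow> smooth N b \<Longrightarrow> smooth N (a * b)"
  by (auto simp: smooth_def prime_dvd_mult_iff)

lemma smooth_1 [simp]: "smooth N 1"
  by (auto simp: smooth_def)

lemma smooth_dvd_fact_power:
  assumes "x dvd fact N ^ n"
  shows "smooth N x"
  unfolding smooth_def
proof (intro conjI allI impI)
  show "x \<noteq> 0" using assms by auto
  fix q :: nat assume q: "prime q" "int q dvd x"
  then have "int q dvd fact N ^ n" using assms dvd_trans by blast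
  then have "int q dvd int (fact N)" using q(1) by (simp add: prime_dvd_power)
  then have "q dvd fact N" by (simp only: int_dvd_int_iff)
  then show "q \<le> N" using q(1) by (simp add: prime_dvd_fact_iff)
qed

lemma Q_smooth_iff:
  "x \<in> Q_smooth N \<longleftrightarrow> (\<exists>a b. smooth N b \<and> x = of_int a / of_int b)"
proof
  assume x: "x \<in> Q_smooth N"
  obtain a b where q: "quotient_of x = (a, b)" by (cases "quotient_of x") auto
  have "smooth N b"
    using x q quotient_of_denom_pos[OF q] by (auto simp: Q_smooth_def smooth_def)
  then show "\<exists>a b. smooth N b \<and> x = of_int a / of_int b"
    using quotient_of_div[OF q] by blast
next
  assume "\<exists>a b. smooth N b \<and> x = of_int a / of_int b"
  then obtain a b where b: "smooth N b" and x: "x = of_int a / of_int b" by blast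
  obtain n d where q: "quotient_of x = (n, d)" by (cases "quotient_of x") auto
  have d: "d > 0" and cop: "coprime n d" and x': "x = of_int n / of_int d"
    using quotient_of_denom_pos[OF q] quotient_of_coprime[OF q] quotient_of_div[OF q] by auto
  have "b \<noteq> 0" using b by (simp add: smooth_def)
  then have "of_int (n * b) = (of_int (a * d) :: rat)"
    using x x' d by (simp add: field_simps)
  then have "n * b = a * d" by (simp only: of_int_eq_iff)
  then have "d dvd n * b" by simp
  then have "d dvd b" using cop by (simp add: coprime_commute coprime_dvd_mult_right_iff)
  then show "x \<in> Q_smooth N"
    using b q by (auto simp: Q_smooth_def smooth_def intro: dvd_trans)
qed

lemma Q_smooth_of_int [simp]: "of_int a \<in> Q_smooth N"
  unfolding Q_smooth_iff by (intro exI[of _ a] exI[of _ 1]) simp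

lemma Q_smooth_0 [simp]: "0 \<in> Q_smooth N" and Q_smooth_1 [simp]: "1 \<in> Q_smooth N"
  using Q_smooth_of_int[of 0 N] Q_smooth_of_int[of 1 N] by simp_all

lemma Q_smooth_add:
  assumes "x \<in> Q_smooth N" "y \<in> Q_smooth N"
  shows "x + y \<in> Q_smooth N"
proof -
  obtain a b where ab: "smooth N b" "x = of_int a / of_int b"
    using assms unfolding Q_smooth_iff by blast
  obtain a' b' where ab': "smooth N b'" "y = of_int a' / of_int b'"
    using assms unfolding Q_smooth_iff by blast
  have "b \<noteq> 0" "b' \<noteq> 0" using ab ab' by (auto simp: smooth_def)
  then have "x + y = of_int (a * b' + a' * b) / of_int (b * b')"
    using ab ab' by (simp add: field_simps)
  then show ?thesis using smooth_mult ab ab' unfolding Q_smooth_iff by blast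
qed

lemma Q_smooth_mult:
  assumes "x \<in> Q_smooth N" "y \<in> Q_smooth N"
  shows "x * y \<in> Q_smooth N"
proof -
  obtain a b where ab: "smooth N b" "x = of_int a / of_int b"
    using assms unfolding Q_smooth_iff by blast
  obtain a' b' where ab': "smooth N b'" "y = of_int a' / of_int b'"
    using assms unfolding Q_smooth_iff by blast
  have "x * y = of_int (a * a') / of_int (b * b')" using ab ab' by simp
  then show ?thesis using smooth_mult ab ab' unfolding Q_smooth_iff by blast
qed

lemma Q_smooth_inverse: "smooth N b \<Longrightarrow> 1 / of_int b \<in> Q_smooth N"
  unfolding Q_smooth_iff by (intro exI[of _ 1] exI[of _ b]) simp

lemma p_integral_Q_smooth:
  assumes "prime p" "N < p" "x \<in> Q_smooth N"
  shows "p_integral p x"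
proof -
  obtain a b where ab: "smooth N b" "x = of_int a / of_int b"
    using assms unfolding Q_smooth_iff by blast
  then have "\<not> int p dvd b" using assms by (auto simp: smooth_def)
  then show ?thesis using ab p_integral_divide_of_int[of p "of_int a" b] assms by simp
qed

text \<open>Sequences indexed by the primes that have the form asked for in the theorem, with constants that do not
  depend on the prime. For one generator, \<open>h\<close> is taken to be \<open>0\<close>.\<close>

definition cong_span :: "nat \<Rightarrow> (nat \<Rightarrow> rat) \<Rightarrow> (nat \<Rightarrow> rat) \<Rightarrow> (nat \<Rightarrow> rat) set" where
  "cong_span N g h = {f. \<exists>\<alpha>\<in>Q_smooth N. \<exists>\<beta>\<in>Q_smooth N. \<forall>p. prime p \<and> p > 7 \<longrightarrow>
     rat_cong (f p) (\<alpha> * g p + \<beta> * h p) p}"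

lemma cong_spanI:
  "\<alpha> \<in> Q_smooth N \<Longrightarrow> \<beta> \<in> Q_smooth N \<Longrightarrow>
   (\<And>p. prime p \<Longrightarrow> p > 7 \<Longrightarrow> rat_cong (f p) (\<alpha> * g p + \<beta> * h p) p) \<Longrightarrow> f \<in> cong_span N g h"
  unfolding cong_span_def by blast

lemma cong_spanE:
  assumes "f \<in> cong_span N g h"
  obtains \<alpha> \<beta> where "\<alpha> \<in> Q_smooth N" "\<beta> \<in> Q_smooth N"
    "\<And>p. prime p \<Longrightarrow> p > 7 \<Longrightarrow> rat_cong (f p) (\<alpha> * g p + \<beta> * h p) p"
  using assms unfolding cong_span_def by blast

lemma cong_span_cong:
  assumes "f \<in> cong_span N g h" "\<And>p. prime p \<Longrightarrow> p > 7 \<Longrightarrow> rat_cong (f' p) (f p) p"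
  shows "f' \<in> cong_span N g h"
proof -
  obtain \<alpha> \<beta> where "\<alpha> \<in> Q_smooth N" "\<beta> \<in> Q_smooth N"
    "\<And>p. prime p \<Longrightarrow> p > 7 \<Longrightarrow> rat_cong (f p) (\<alpha> * g p + \<beta> * h p) p"
    using assms(1) by (rule cong_spanE) blast
  then show ?thesis using assms(2) by (intro cong_spanI[of \<alpha> _ \<beta>]) (auto intro: rat_cong_trans)
qed

lemma cong_span_0: "(\<lambda>p. 0) \<in> cong_span N g h"
  by (rule cong_spanI[of 0 _ 0]) auto

lemma cong_span_add:
  assumes "f \<in> cong_span N g h" "f' \<in> cong_span N g h"
  shows "(\<lambda>p. f p + f' p) \<in> cong_span N g h"
proof -
  obtain \<alpha> \<beta> where 1: "\<alpha> \<in> Q_smooth N" "\<beta> \<in> Q_smooth N"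
    "\<And>p. prime p \<Longrightarrow> p > 7 \<Longrightarrow> rat_cong (f p) (\<alpha> * g p + \<beta> * h p) p"
    using assms(1) by (rule cong_spanE) blast
  obtain \<alpha>' \<beta>' where 2: "\<alpha>' \<in> Q_smooth N" "\<beta>' \<in> Q_smooth N"
    "\<And>p. prime p \<Longrightarrow> p > 7 \<Longrightarrow> rat_cong (f' p) (\<alpha>' * g p + \<beta>' * h p) p"
    using assms(2) by (rule cong_spanE) blast
  show ?thesis
  proof (rule cong_spanI)
    fix p :: nat assume p: "prime p" "p > 7"
    have "rat_cong (f p + f' p) ((\<alpha> * g p + \<beta> * h p) + (\<alpha>' * g p + \<beta>' * h p)) p"
      using rat_cong_add p 1(3) 2(3) by blast
    then show "rat_cong (f p + f' p) ((\<alpha> + \<alpha>') * g p + (\<beta> + \<beta>') * h p) p"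
      by (simp add: algebra_simps)
  qed (use 1 2 Q_smooth_add in auto)
qed

lemma cong_span_scale:
  assumes "f \<in> cong_span N g h" "c \<in> Q_smooth N" "N \<le> 7"
  shows "(\<lambda>p. c * f p) \<in> cong_span N g h"
proof -
  obtain \<alpha> \<beta> where 1: "\<alpha> \<in> Q_smooth N" "\<beta> \<in> Q_smooth N"
    "\<And>p. prime p \<Longrightarrow> p > 7 \<Longrightarrow> rat_cong (f p) (\<alpha> * g p + \<beta> * h p) p"
    using assms(1) by (rule cong_spanE) blast
  show ?thesis
  proof (rule cong_spanI)
    fix p :: nat assume p: "prime p" "p > 7"
    then have "p_integral p c" using assms(2,3) by (intro p_integral_Q_smooth[of p N]) auto
    then have "rat_cong (c * f p) (c * (\<alpha> * g p + \<beta> * h p)) p"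
      using rat_cong_mult_left p 1(3) by blast
    then show "rat_cong (c * f p) ((c * \<alpha>) * g p + (c * \<beta>) * h p) p"
      by (simp add: algebra_simps)
  qed (use 1 assms Q_smooth_mult in auto)
qed

lemma cong_span_divide:
  assumes "(\<lambda>p. of_int c * f p) \<in> cong_span N g h" "smooth N c" "N \<le> 7"
  shows "f \<in> cong_span N g h"
  using cong_span_scale[OF assms(1) Q_smooth_inverse[OF assms(2)] assms(3)] assms(2)
  by (simp add: smooth_def)

lemma cong_span_sum_list:
  "(\<And>x. x \<in> set L \<Longrightarrow> f x \<in> cong_span N g h) \<Longrightarrow> (\<lambda>p. \<Sum>x\<leftarrow>L. f x p) \<in> cong_span N g h"
  by (induction L) (auto intro: cong_span_0 cong_span_add)

section \<open>Gaussian elimination with smooth pivots\<close>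

text \<open>The first column of \<open>v\<close> is cleared with the pivot row \<open>r\<close> and then dropped. A row that has a \<open>0\<close> there
  is not multiplied by the pivot, which keeps the numbers small.\<close>

definition eliminate :: "int list \<Rightarrow> int list \<Rightarrow> int list" where
  "eliminate r v = (if hd v = 0 then tl v else
     map2 (\<lambda>x y. hd r * x - hd v * y) (tl v) (tl r))"

text \<open>Fraction-free elimination on \<open>n\<close> columns. Dividing a high power of \<open>c\<close> is a computable way to say that a
  pivot has no prime factor other than those of \<open>c\<close>; pivots with exponents above 60 are not accepted.\<close>

fun solvable :: "int \<Rightarrow> nat \<Rightarrow> int list list \<Rightarrow> bool" where
  "solvable c 0 rows = True"
| "solvable c (Suc n) rows = (case List.extract (\<lambda>r. hd r dvd c ^ 60) rows of None \<Rightarrow> False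
    | Some (xs, r, ys) \<Rightarrow> solvable c n (map (eliminate r) (xs @ ys)))"

definition combine :: "int list \<Rightarrow> (nat \<Rightarrow> rat) list \<Rightarrow> nat \<Rightarrow> rat" where
  "combine v fs p = (\<Sum>(x, f)\<leftarrow>zip v fs. of_int x * f p)"

lemma combine_Cons [simp]: "combine (x # v) (f # fs) p = of_int x * f p + combine v fs p"
  by (simp add: combine_def)

lemma combine_map2:
  "length v = length fs \<Longrightarrow> length r = length fs \<Longrightarrow>
   combine (map2 (\<lambda>x y. a * x - b * y) v r) fs p = of_int a * combine v fs p - of_int b * combine r fs p"
proof (induction fs arbitrary: v r)
  case (Cons f fs)
  then obtain x v' y r' where "v = x # v'" "r = y # r'" by (metis length_Suc_conv)
  then show ?case using Cons by (simp add: algebra_simps)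
qed (simp add: combine_def)

text \<open>If the pivot row \<open>r\<close> lies in the module, the rows after elimination do so as well; once the remaining
  unknowns are known to lie in the module, so does the pivot times the first unknown.\<close>

lemma solvable_imp_mem:
  assumes "solvable (fact N) (length fs) rows" "N \<le> 7"
    "\<And>v. v \<in> set rows \<Longrightarrow> length v = length fs \<and> combine v fs \<in> cong_span N g h"
  shows "set fs \<subseteq> cong_span N g h"
  using assms(1,3)
proof (induction fs arbitrary: rows)
  case (Cons f fs)
  note rows = Cons.prems(2)
  obtain xs r ys where e: "List.extract (\<lambda>r. hd r dvd fact N ^ 60) rows = Some (xs, r, ys)"
    and s: "solvable (fact N) (length fs) (map (eliminate r) (xs @ ys))"
    using Cons.prems(1) by (auto split: option.splits)
  have split: "rows = xs @ r # ys" and piv: "hd r dvd fact N ^ 60"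
    using extract_SomeE[OF e] by auto
  have "length r = Suc (length fs)" using rows[of r] split by simp
  then obtain a r' where r: "r = a # r'" and r': "length r' = length fs" by (cases r) auto
  have a: "smooth N a" using piv r smooth_dvd_fact_power by simp
  have rM: "(\<lambda>p. of_int a * f p + combine r' fs p) \<in> cong_span N g h"
    using rows[of r] split r by (simp flip: combine_Cons)
  have fs: "set fs \<subseteq> cong_span N g h"
  proof (rule Cons.IH[OF s])
    fix v' assume "v' \<in> set (map (eliminate r) (xs @ ys))"
    then obtain v where v: "v' = eliminate r v" "v \<in> set rows" using split by auto
    have "length v = Suc (length fs)" using rows[OF v(2)] by simp
    then obtain b w where w: "v = b # w" "length w = length fs" by (cases v) auto
    have vM: "(\<lambda>p. of_int b * f p + combine w fs p) \<in> cong_span N g h"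
      using rows[OF v(2)] w by (simp flip: combine_Cons)
    show "length v' = length fs \<and> combine v' fs \<in> cong_span N g h"
    proof (cases "b = 0")
      case True
      then show ?thesis using v w vM by (simp add: eliminate_def)
    next
      case False
      have "(\<lambda>p. of_int a * (of_int b * f p + combine w fs p) +
          of_int (- b) * (of_int a * f p + combine r' fs p)) \<in> cong_span N g h"
        by (rule cong_span_add[OF cong_span_scale[OF vM Q_smooth_of_int assms(2)]
              cong_span_scale[OF rM Q_smooth_of_int assms(2)]])
      also have "(\<lambda>p. of_int a * (of_int b * f p + combine w fs p) +
          of_int (- b) * (of_int a * f p + combine r' fs p)) = combine v' fs"
        (is "?f = _")
      proof
        fix p
        have "combine v' fs p = of_int a * combine w fs p - of_int b * combine r' fs p"
          using False v w r r' by (simp add: eliminate_def combine_map2)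
        then show "?f p = combine v' fs p" by (simp add: algebra_simps)
      qed
      finally show ?thesis using False v w r r' by (simp add: eliminate_def)
    qed
  qed
  have "combine r' fs \<in> cong_span N g h"
  proof -
    have "(\<lambda>p. \<Sum>z\<leftarrow>zip r' fs. of_int (fst z) * snd z p) \<in> cong_span N g h"
      using fs assms(2) by (intro cong_span_sum_list cong_span_scale) (auto dest: set_zip_rightD)
    then show ?thesis by (simp add: combine_def[abs_def] case_prod_unfold)
  qed
  from cong_span_add[OF rM cong_span_scale[OF this Q_smooth_of_int[of "-1"] assms(2)]]
  have "(\<lambda>p. of_int a * f p) \<in> cong_span N g h" by simp
  then have "f \<in> cong_span N g h" using a assms(2) by (rule cong_span_divide)
  then show ?case using fs by simp
qed simp

section \<open>Relations between sums of one weight\<close>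

text \<open>The relations that enter the linear systems, given by the two lists to be multiplied.
  \<open>Reduced_Shuffle\<close> is a shuffle relation of depth one higher: in weights 6 and 9 the relations in the
  depth under consideration leave one degree of freedom, and this is where the missing ones come from.
  A formal integral combination of sums is a list of pairs of a coefficient and a list of exponents.\<close>

datatype relation = Stuffle "nat list" "nat list" | Shuffle "nat list" "nat list"
  | Reduced_Shuffle "nat list" "nat list"

definition shuffle_terms :: "nat list \<Rightarrow> nat list \<Rightarrow> (int \<times> nat list) list" where
  "shuffle_terms u v = (- ((-1) ^ sum_list v), rev v @ u) #
     map (\<lambda>w. (1, composition 0 w)) (shuffle (word u) (word v))"

text \<open>Twice the given combination, in which the sums of depth \<open>m\<close> have been replaced by means of the antipode
  relation \<open>2 H(s) + (sum of H over the proper coarsenings of s) = 0\<close>, which holds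
  modulo products if \<open>w + m\<close> is even.\<close>

definition reduce_depth :: "nat \<Rightarrow> (int \<times> nat list) list \<Rightarrow> (int \<times> nat list) list" where
  "reduce_depth m L = concat (map (\<lambda>(a, s).
     if length s = m then map (Pair (- a)) (tl (coarsenings s)) else [(2 * a, s)]) L)"

primrec terms :: "nat \<Rightarrow> relation \<Rightarrow> (int \<times> nat list) list" where
  "terms m (Stuffle u v) = map (Pair 1) (stuffle u v)"
| "terms m (Shuffle u v) = shuffle_terms u v"
| "terms m (Reduced_Shuffle u v) = reduce_depth m (shuffle_terms u v)"

primrec well_formed :: "nat \<Rightarrow> relation \<Rightarrow> bool" where
  "well_formed w (Stuffle u v) \<longleftrightarrow> u \<noteq> [] \<and> v \<noteq> [] \<and> 0 \<notin> set (u @ v) \<and> sum_list (u @ v) = w"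
| "well_formed w (Shuffle u v) \<longleftrightarrow> 0 \<notin> set (u @ v) \<and> sum_list (u @ v) = w"
| "well_formed w (Reduced_Shuffle u v) \<longleftrightarrow> 0 \<notin> set (u @ v) \<and> sum_list (u @ v) = w"

text \<open>The coefficient of the sum for \<open>b\<close>, where the sum for \<open>rev b\<close> counts as \<open>(-1)\<^sup>w\<close> times the one for \<open>b\<close>.\<close>

definition coordinate :: "nat \<Rightarrow> nat list \<Rightarrow> (int \<times> nat list) list \<Rightarrow> int" where
  "coordinate w b L = (\<Sum>(a, s)\<leftarrow>L. if s = b then a else if s = rev b then (-1) ^ w * a else 0)"

primrec compositions :: "nat \<Rightarrow> nat \<Rightarrow> nat list list" where
  "compositions w 0 = (if w = 0 then [[]] else [])"
| "compositions w (Suc m) =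
     concat (map (\<lambda>a. map ((#) a) (compositions (w - a) m)) [1..<Suc w])"

lemma set_compositions:
  "0 \<notin> set s \<Longrightarrow> s \<in> set (compositions (sum_list s) (length s))"
proof (induction s)
  case (Cons a s)
  then show ?case by (auto simp del: upt_Suc intro!: bexI[of _ a])
qed simp

text \<open>The list \<open>B\<close> contains one of \<open>s\<close> and \<open>rev s\<close> for each list \<open>s\<close> of weight \<open>w\<close> and depth \<open>m\<close>, and the
  relations \<open>R\<close> determine the corresponding sums up to products and sums of smaller depth.\<close>

definition certifies :: "nat \<Rightarrow> int \<Rightarrow> nat \<Rightarrow> nat list list \<Rightarrow> relation list \<Rightarrow> bool" where
  "certifies w c m B R = (let C = map (terms (Suc m)) R in
     distinct B \<and> list_all (\<lambda>b. rev b = b \<or> rev b \<notin> set B) B \<and> list_all (well_formed w) R \<and>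
     list_all (\<lambda>s. s \<in> set B \<or> rev s \<in> set B) (compositions w m) \<and>
     list_all (list_all (\<lambda>(a, s). length s \<le> m)) C \<and>
     solvable c (length B) (map (\<lambda>L. map (\<lambda>b. coordinate w b L) B) C))"

lemma composition_word: "0 \<notin> set s \<Longrightarrow> composition 0 (word s) = s"
proof (induction s)
  case (Cons a s)
  have "composition c (replicate k False @ True # v) = Suc (c + k) # composition 0 v" for c k v
    by (induction k arbitrary: c) auto
  then show ?case using Cons by auto
qed simp

lemma shuffle_terms_pos:
  assumes "(a, s) \<in> set (shuffle_terms u v)" "0 \<notin> set u" "0 \<notin> set v"
  shows "0 \<notin> set s \<and> sum_list s = sum_list u + sum_list v"
proof (cases "s = rev v @ u")
  case True
  then show ?thesis using assms by simp
next
  case False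
  then obtain w where w: "w \<in> set (shuffle (word u) (word v))" "s = composition 0 w"
    using assms(1) by (auto simp: shuffle_terms_def)
  have "admissible w" using w(1) admissible_shuffle admissible_word by blast
  then have "sum_list s = length w"
    using length_word[OF composition_pos, of 0 w] word_composition_0 w(2) by metis
  also have "\<dots> = length (word u) + length (word v)"
    using mset_shuffle[OF w(1)] by (metis size_mset size_union)
  finally show ?thesis using assms w(2) by (simp add: length_word composition_pos)
qed

text \<open>The setting for one weight \<open>w\<close>: a module of sequences that contains all products of two sums of
  total weight \<open>w\<close>. Modulo it, all relations become linear.\<close>

locale weight_module =
  fixes N w :: nat and g h :: "nat \<Rightarrow> rat"
  assumes N: "2 \<le> N" "N \<le> 7"
  assumes products: "\<And>u v. u \<noteq> [] \<Longrightarrow> v \<noteq> [] \<Longrightarrow> 0 \<notin> set u \<Longrightarrow> 0 \<notin> set v \<Longrightarrow>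
    sum_list u + sum_list v = w \<Longrightarrow> (\<lambda>p. H u (p - 1) * H v (p - 1)) \<in> cong_span N g h"
begin

abbreviation M :: "(nat \<Rightarrow> rat) set" where
  "M \<equiv> cong_span N g h"

definition terms_value :: "(int \<times> nat list) list \<Rightarrow> nat \<Rightarrow> rat" where
  "terms_value L p = (\<Sum>(a, s)\<leftarrow>L. of_int a * H s (p - 1))"

text \<open>All sums of weight \<open>w\<close> and depth at most \<open>d\<close> lie in the module; the proofs below raise \<open>d\<close> step by
  step.\<close>

definition covered :: "nat \<Rightarrow> bool" where
  "covered d \<longleftrightarrow> (\<forall>s. 0 \<notin> set s \<and> sum_list s = w \<and> length s \<le> d \<longrightarrow> (\<lambda>p. H s (p - 1)) \<in> M)"

lemma coveredD:
  "covered d \<Longrightarrow> 0 \<notin> set s \<Longrightarrow> sum_list s = w \<Longrightarrow> length s \<le> d \<Longrightarrow> (\<lambda>p. H s (p - 1)) \<in> M"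
  by (auto simp: covered_def)

lemma terms_value_simps [simp]:
  "terms_value [] p = 0" "terms_value ((a, s) # L) p = of_int a * H s (p - 1) + terms_value L p"
  "terms_value (L @ L') p = terms_value L p + terms_value L' p"
  by (simp_all add: terms_value_def)

lemma terms_value_map_Pair: "terms_value (map (Pair a) L) p = of_int a * (\<Sum>s\<leftarrow>L. H s (p - 1))"
  by (induction L) (auto simp: algebra_simps)

lemma scale: "f \<in> M \<Longrightarrow> (\<lambda>p. of_int a * f p) \<in> M"
  using N by (intro cong_span_scale) auto

lemma scale_minus: "f \<in> M \<Longrightarrow> (\<lambda>p. - f p) \<in> M"
  using scale[of f "-1"] by simp

lemma diff:
  assumes "f \<in> M" "f' \<in> M"
  shows "(\<lambda>p. f p - f' p) \<in> M"
  using cong_span_add[OF assms(1) scale_minus[OF assms(2)]] by simp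

lemma halve:
  assumes "(\<lambda>p. 2 * f p) \<in> M"
  shows "f \<in> M"
proof (rule cong_span_divide)
  have "q \<le> N" if "int q dvd 2" for q
    using zdvd_imp_le[OF that] N(1) by simp
  then show "smooth N 2" unfolding smooth_def by simp
  show "(\<lambda>p. of_int 2 * f p) \<in> M" using assms by simp
qed (rule N)

lemma mem_cong:
  "(\<And>p. prime p \<Longrightarrow> rat_cong (f p) (f' p) p) \<Longrightarrow> f' \<in> M \<Longrightarrow> f \<in> M"
  by (rule cong_span_cong)

lemma sign_scale: "f \<in> M \<Longrightarrow> (\<lambda>p. (-1) ^ n * f p) \<in> M"
  using scale[of f "(-1) ^ n"] by simp

lemma stuffle_mem:
  assumes "u \<noteq> []" "v \<noteq> []" "0 \<notin> set u" "0 \<notin> set v" "sum_list u + sum_list v = w"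
  shows "terms_value (map (Pair 1) (stuffle u v)) \<in> M"
  using products[OF assms] by (simp add: H_mult terms_value_map_Pair[abs_def])

lemma shuffle_mem:
  assumes "0 \<notin> set u" "0 \<notin> set v"
  shows "terms_value (shuffle_terms u v) \<in> M"
proof (rule mem_cong)
  fix p :: nat assume p: "prime p"
  let ?S = "\<Sum>w\<leftarrow>shuffle (word u) (word v). H (composition 0 w) (p - 1)"
  have "terms_value (map (\<lambda>w. (1, composition 0 w)) L) p = (\<Sum>w\<leftarrow>L. H (composition 0 w) (p - 1))" for L
    by (induction L) auto
  then have "terms_value (shuffle_terms u v) p = ?S + - ((-1) ^ sum_list v * H (rev v @ u) (p - 1))"
    by (simp add: shuffle_terms_def)
  also have "rat_cong \<dots> ((-1) ^ sum_list v * H (rev v @ u) (p - 1) + - ((-1) ^ sum_list v * H (rev v @ u) (p - 1))) p"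
    using p assms by (intro rat_cong_add shuffle_relation) auto
  finally show "rat_cong (terms_value (shuffle_terms u v) p) 0 p" by simp
qed (rule cong_span_0)

text \<open>This is the shuffle relation with an empty first factor.\<close>

lemma reversal_mem:
  assumes "0 \<notin> set s"
  shows "(\<lambda>p. H s (p - 1) - (-1) ^ sum_list s * H (rev s) (p - 1)) \<in> M"
  using shuffle_mem[of "[]" s] assms
  by (simp add: shuffle_terms_def composition_word terms_value_def[abs_def])

lemma product_star_mem:
  assumes "u \<noteq> []" "v \<noteq> []" "0 \<notin> set u" "0 \<notin> set v" "sum_list u + sum_list v = w"
  shows "(\<lambda>p. H u (p - 1) * S v (p - 1)) \<in> M"
proof -
  have "(\<lambda>p. \<Sum>t\<leftarrow>coarsenings v. H u (p - 1) * H t (p - 1)) \<in> M"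
    using assms coarsenings_Nil coarsenings_pos coarsenings_sum_list
    by (intro cong_span_sum_list products) auto
  then show ?thesis by (simp add: S_eq_sum_coarsenings sum_list_const_mult)
qed

text \<open>All but the two extreme terms of the antipode relation are products.\<close>

lemma antipode_mem:
  assumes "0 \<notin> set s" "sum_list s = w" "s \<noteq> []"
  shows "(\<lambda>p. (-1) ^ w * S s (p - 1) + (-1) ^ length s * H s (p - 1)) \<in> M"
proof -
  define f where "f = (\<lambda>i p. (-1) ^ (i + sum_list (drop i s)) * H (take i s) (p - 1) * S (drop i s) (p - 1))"
  have pos: "0 \<notin> set (take i s)" "0 \<notin> set (drop i s)" for i
    using assms(1) by (auto dest: in_set_takeD in_set_dropD)
  have mid: "(\<lambda>p. \<Sum>i\<leftarrow>[1..<length s]. f i p) \<in> M"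
  proof (rule cong_span_sum_list)
    fix i assume i: "i \<in> set [1..<length s]"
    have "sum_list (take i s) + sum_list (drop i s) = w"
      using assms(2) by (metis append_take_drop_id sum_list_append)
    then have "(\<lambda>p. H (take i s) (p - 1) * S (drop i s) (p - 1)) \<in> M"
      using i pos assms(3) by (intro product_star_mem) auto
    then show "f i \<in> M"
      using sign_scale[of _ "i + sum_list (drop i s)"] by (simp add: f_def mult.assoc)
  qed
  have all: "(\<lambda>p. \<Sum>i\<le>length s. f i p) \<in> M"
    by (rule mem_cong[OF _ cong_span_0]) (use antipode assms in \<open>auto simp: f_def\<close>)
  have "(\<lambda>p. (\<Sum>i\<le>length s. f i p) - (\<Sum>i\<leftarrow>[1..<length s]. f i p)) \<in> M"
    using all mid by (rule diff)
  moreover have "(\<Sum>i\<le>length s. f i p) = f 0 p + (\<Sum>i\<leftarrow>[1..<length s]. f i p) + f (length s) p" for p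
  proof -
    have "{..length s} = insert 0 (insert (length s) {1..<length s})" using assms(3) by auto
    then show ?thesis using assms(3) by (simp add: sum_list_distinct_conv_sum_set)
  qed
  ultimately show ?thesis using assms(2) by (simp add: f_def)
qed

text \<open>For even \<open>w + length s\<close> the two extreme terms of the antipode relation have the same sign, and the leading
  terms add up instead of cancelling.\<close>

lemma parity_mem:
  assumes "0 \<notin> set s" "sum_list s = w" "s \<noteq> []" "even (w + length s)"
  shows "(\<lambda>p. 2 * H s (p - 1) + (\<Sum>t\<leftarrow>tl (coarsenings s). H t (p - 1))) \<in> M"
proof -
  obtain L where L: "coarsenings s = s # L" using coarsenings_Cons by blast
  have "(\<lambda>p. (-1) ^ w * ((-1) ^ w * S s (p - 1) + (-1) ^ length s * H s (p - 1))) \<in> M"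
    using assms antipode_mem sign_scale by blast
  moreover have "(-1) ^ w * ((-1) ^ w * x + (-1) ^ length s * y) = x + (y :: rat)" for x y
    using assms(4) by (cases "even w") auto
  ultimately have "(\<lambda>p. S s (p - 1) + H s (p - 1)) \<in> M" by simp
  then show ?thesis by (simp add: S_eq_sum_coarsenings L algebra_simps)
qed

lemma covered_Suc_parity:
  assumes "covered d" "even (w + Suc d)"
  shows "covered (Suc d)"
  unfolding covered_def
proof (intro allI impI)
  fix s assume s: "0 \<notin> set s \<and> sum_list s = w \<and> length s \<le> Suc d"
  show "(\<lambda>p. H s (p - 1)) \<in> M"
  proof (cases "length s = Suc d")
    case True
    then have ne: "s \<noteq> []" by auto
    obtain L where L: "coarsenings s = s # L" "\<forall>t\<in>set L. length t < length s"
      using coarsenings_Cons by blast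
    have low: "(\<lambda>p. \<Sum>t\<leftarrow>L. H t (p - 1)) \<in> M"
    proof (rule cong_span_sum_list)
      fix t assume "t \<in> set L"
      then have t: "t \<in> set (coarsenings s)" "length t \<le> d" using L True by auto
      then show "(\<lambda>p. H t (p - 1)) \<in> M"
        using s coarsenings_pos coarsenings_sum_list by (intro coveredD[OF assms(1)]) metis+
    qed
    have "(\<lambda>p. 2 * H s (p - 1) + (\<Sum>t\<leftarrow>tl (coarsenings s). H t (p - 1))) \<in> M"
      using s ne True assms(2) by (intro parity_mem) simp_all
    from diff[OF this low] have "(\<lambda>p. 2 * H s (p - 1)) \<in> M" by (simp add: L(1))
    then show ?thesis by (rule halve)
  qed (use s coveredD[OF assms(1), of s] in auto)
qed

text \<open>For depth greater than \<open>d\<close> the dual of \<open>s\<close> has depth \<open>w + 1 - length s \<le> d\<close>. This settles all sums \<open>S\<close>,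
  and then, by induction on the depth, all sums \<open>H\<close>, because \<open>S(s)\<close> is \<open>H(s)\<close> plus sums of smaller depth.\<close>

lemma covered_duality:
  assumes "covered d" "w \<le> 2 * d" "0 \<notin> set s" "sum_list s = w"
  shows "(\<lambda>p. H s (p - 1)) \<in> M" "(\<lambda>p. S s (p - 1)) \<in> M"
proof -
  have low: "(\<lambda>p. S s (p - 1)) \<in> M" if "0 \<notin> set s" "sum_list s = w" "length s \<le> d" for s
  proof -
    have "(\<lambda>p. \<Sum>t\<leftarrow>coarsenings s. H t (p - 1)) \<in> M"
    proof (intro cong_span_sum_list coveredD[OF assms(1)])
      fix t assume t: "t \<in> set (coarsenings s)"
      obtain L where "coarsenings s = s # L" "\<forall>t\<in>set L. length t < length s"
        using coarsenings_Cons by blast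
      then show "length t \<le> d" using t that(3) by auto
      show "0 \<notin> set t" "sum_list t = w" using coarsenings_pos[OF t] coarsenings_sum_list[OF t] that by auto
    qed
    then show ?thesis by (simp add: S_eq_sum_coarsenings)
  qed
  have star: "(\<lambda>p. S s (p - 1)) \<in> M" if s: "0 \<notin> set s" "sum_list s = w" for s
  proof (cases "length s \<le> d")
    case False
    then have "s \<noteq> []" by auto
    from duality[OF s(1) this] obtain t where t: "0 \<notin> set t" "t \<noteq> []" "sum_list t = sum_list s"
      "length s + length t = sum_list s + 1"
      "\<And>p. prime p \<Longrightarrow> rat_cong (S s (p - 1)) (- S t (p - 1)) p"
      by metis
    have "(\<lambda>p. S t (p - 1)) \<in> M" using t s False assms(2) by (intro low) auto
    from mem_cong[OF t(5) scale_minus[OF this]] show ?thesis .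
  qed (use low s in auto)
  show "(\<lambda>p. S s (p - 1)) \<in> M" using assms(3,4) by (rule star)
  show "(\<lambda>p. H s (p - 1)) \<in> M"
    using assms(3,4)
  proof (induction "length s" arbitrary: s rule: less_induct)
    case less
    obtain L where L: "coarsenings s = s # L" "\<forall>t\<in>set L. length t < length s"
      using coarsenings_Cons by blast
    have "(\<lambda>p. \<Sum>t\<leftarrow>L. H t (p - 1)) \<in> M"
    proof (intro cong_span_sum_list less.hyps)
      fix t assume t: "t \<in> set L"
      then have t': "t \<in> set (coarsenings s)" using L by simp
      show "length t < length s" using L t by blast
      show "0 \<notin> set t" "sum_list t = w"
        using coarsenings_pos[OF t'] coarsenings_sum_list[OF t'] less.prems by auto
    qed
    from diff[OF star[OF less.prems] this] show ?case
      by (simp add: S_eq_sum_coarsenings L)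
  qed
qed

lemma reduce_depth_mem:
  assumes "terms_value L \<in> M" "\<forall>(a, s)\<in>set L. 0 \<notin> set s \<and> sum_list s = w" "0 < m" "even (w + m)"
  shows "terms_value (reduce_depth m L) \<in> M"
proof -
  have "(\<lambda>p. 2 * terms_value L p - terms_value (reduce_depth m L) p) \<in> M"
    using assms(2)
  proof (induction L)
    case (Cons x L)
    obtain a s where x: "x = (a, s)" by (cases x)
    have IH: "(\<lambda>p. 2 * terms_value L p - terms_value (reduce_depth m L) p) \<in> M" using Cons by auto
    show ?case
    proof (cases "length s = m")
      case True
      then have "(\<lambda>p. of_int a * (2 * H s (p - 1) + (\<Sum>t\<leftarrow>tl (coarsenings s). H t (p - 1)))) \<in> M"
        using Cons.prems x assms(3,4) by (intro scale parity_mem) auto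
      from cong_span_add[OF this IH] show ?thesis
        using True by (simp add: x reduce_depth_def terms_value_map_Pair algebra_simps)
    qed (use IH in \<open>simp add: x reduce_depth_def algebra_simps\<close>)
  qed (simp add: reduce_depth_def cong_span_0)
  from diff[OF scale[OF assms(1), of 2] this] show ?thesis by simp
qed

lemma terms_mem:
  assumes "well_formed w r" "0 < m" "even (w + m)"
  shows "terms_value (terms m r) \<in> M"
proof (cases r)
  case (Reduced_Shuffle u v)
  then have uv: "0 \<notin> set u" "0 \<notin> set v" "sum_list u + sum_list v = w"
    using assms(1) by auto
  then show ?thesis using assms(2,3) shuffle_terms_pos Reduced_Shuffle
    by (auto intro!: reduce_depth_mem shuffle_mem)
qed (use assms in \<open>auto intro: stuffle_mem shuffle_mem\<close>)

lemma terms_pos: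
  assumes "well_formed w r" "(a, s) \<in> set (terms m r)"
  shows "0 \<notin> set s \<and> sum_list s = w"
proof (cases r)
  case (Stuffle u v)
  then have "s \<in> set (stuffle u v)" using assms(2) by auto
  from stuffle_pos[OF this] stuffle_sum_list[OF this] show ?thesis
    using assms(1) Stuffle by simp
next
  case (Shuffle u v)
  then show ?thesis using assms shuffle_terms_pos[of a s u v] by simp
next
  case (Reduced_Shuffle u v)
  then obtain b t where t: "(b, t) \<in> set (shuffle_terms u v)"
    "(a, s) \<in> set (if length t = m then map (Pair (- b)) (tl (coarsenings t)) else [(2 * b, t)])"
    using assms(2) by (auto simp: reduce_depth_def)
  obtain L where "coarsenings t = t # L" using coarsenings_Cons by blast
  then have "s \<in> set (coarsenings t)" using t(2) by (auto split: if_splits)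
  from coarsenings_pos[OF this] coarsenings_sum_list[OF this] show ?thesis
    using shuffle_terms_pos[OF t(1)] assms(1) Reduced_Shuffle by simp
qed

text \<open>The coordinates of a single sum represent it modulo the module, since each sum of depth \<open>m\<close> corresponds
  to exactly one element of \<open>B\<close>.\<close>

lemma unit_coordinates_mem:
  assumes B: "distinct B" "\<forall>b\<in>set B. rev b = b \<or> rev b \<notin> set B"
    and s: "0 \<notin> set s" "sum_list s = w" "length s < m \<or> s \<in> set B \<or> rev s \<in> set B"
    and m: "covered (m - 1)"
  shows "(\<lambda>p. H s (p - 1) - (\<Sum>b\<leftarrow>B. of_int (coordinate w b [(1, s)]) * H b (p - 1))) \<in> M"
proof -
  define t where "t = (if s \<in> set B then s else rev s)"
  have eq: "(\<Sum>b\<leftarrow>B. of_int (coordinate w b [(1, s)]) * H b (p - 1)) =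
    (if s \<in> set B then H s (p - 1) else if rev s \<in> set B then (-1) ^ w * H (rev s) (p - 1) else 0)" for p
  proof -
    have "(\<Sum>b\<leftarrow>B. of_int (coordinate w b [(1, s)]) * H b (p - 1)) =
      (\<Sum>b\<in>set B. of_int (coordinate w b [(1, s)]) * H b (p - 1))"
      using B(1) by (simp add: sum_list_distinct_conv_sum_set)
    also have "\<dots> = (\<Sum>b\<in>set B. if b = t then of_int (coordinate w t [(1, s)]) * H t (p - 1) else 0)"
    proof (rule sum.cong)
      fix b assume b: "b \<in> set B"
      show "of_int (coordinate w b [(1, s)]) * H b (p - 1) =
        (if b = t then of_int (coordinate w t [(1, s)]) * H t (p - 1) else 0)"
      proof (cases "b = t")
        case False
        then have "s \<noteq> b" "s \<noteq> rev b" using B(2) b unfolding t_def by (auto split: if_splits)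
        then show ?thesis using False by (simp add: coordinate_def)
      qed simp
    qed simp
    finally show ?thesis by (auto simp: t_def coordinate_def)
  qed
  consider "s \<in> set B" | "s \<notin> set B" "rev s \<in> set B" | "s \<notin> set B" "rev s \<notin> set B" "length s < m"
    using s(3) by blast
  then show ?thesis
  proof cases
    case 1
    then show ?thesis unfolding eq by (simp add: cong_span_0)
  next
    case 2
    then show ?thesis unfolding eq using reversal_mem[OF s(1)] s(2) by simp
  next
    case 3
    then show ?thesis unfolding eq using coveredD[OF m s(1,2)] by simp
  qed
qed

lemma coordinates_mem:
  assumes B: "distinct B" "\<forall>b\<in>set B. rev b = b \<or> rev b \<notin> set B"
    and L: "\<forall>(a, s)\<in>set L. 0 \<notin> set s \<and> sum_list s = w \<and> (length s < m \<or> s \<in> set B \<or> rev s \<in> set B)"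
    and m: "covered (m - 1)" and mem: "terms_value L \<in> M"
  shows "combine (map (\<lambda>b. coordinate w b L) B) (map (\<lambda>b p. H b (p - 1)) B) \<in> M"
proof -
  have comb: "combine (map c B) (map (\<lambda>b p. H b (p - 1)) B) = (\<lambda>p. \<Sum>b\<leftarrow>B. of_int (c b) * H b (p - 1))" for c
    unfolding fun_eq_iff by (induction B) (simp_all, simp add: combine_def)
  have "(\<lambda>p. terms_value L p - (\<Sum>b\<leftarrow>B. of_int (coordinate w b L) * H b (p - 1))) \<in> M"
    using L
  proof (induction L)
    case (Cons x L)
    obtain a s where x: "x = (a, s)" by (cases x)
    have 1: "(\<lambda>p. H s (p - 1) - (\<Sum>b\<leftarrow>B. of_int (coordinate w b [(1, s)]) * H b (p - 1))) \<in> M"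
      using Cons.prems x by (intro unit_coordinates_mem[OF B _ _ _ m]) auto
    have 2: "(\<lambda>p. terms_value L p - (\<Sum>b\<leftarrow>B. of_int (coordinate w b L) * H b (p - 1))) \<in> M"
      using Cons by auto
    have coord: "coordinate w b (x # L) = a * coordinate w b [(1, s)] + coordinate w b L" for b
      by (simp add: coordinate_def x)
    have "(\<Sum>b\<leftarrow>B. of_int (coordinate w b (x # L)) * H b (p - 1)) =
      of_int a * (\<Sum>b\<leftarrow>B. of_int (coordinate w b [(1, s)]) * H b (p - 1)) +
      (\<Sum>b\<leftarrow>B. of_int (coordinate w b L) * H b (p - 1))" for p
      unfolding coord by (induction B) (auto simp: algebra_simps)
    with cong_span_add[OF scale[OF 1, of a] 2] show ?case by (simp add: x algebra_simps)
  qed (simp add: coordinate_def cong_span_0)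
  from diff[OF mem this] show ?thesis unfolding comb by simp
qed

lemma covered_by_certificate:
  assumes "covered (m - 1)" "certifies w c m B R" "c = fact N" "even (w + Suc m)"
  shows "covered m"
proof -
  let ?rows = "map (\<lambda>L. map (\<lambda>b. coordinate w b L) B) (map (terms (Suc m)) R)"
  have B: "distinct B" "\<forall>b\<in>set B. rev b = b \<or> rev b \<notin> set B"
    using assms(2) by (auto simp: certifies_def Let_def list_all_iff)
  have cov: "s \<in> set B \<or> rev s \<in> set B" if "0 \<notin> set s" "sum_list s = w" "length s = m" for s
    using assms(2) set_compositions[of s] that by (auto simp: certifies_def Let_def list_all_iff)
  have len: "\<forall>r\<in>set R. \<forall>(a, s)\<in>set (terms (Suc m) r). length s \<le> m"
    using assms(2) by (simp add: certifies_def Let_def list_all_iff)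
  have "set (map (\<lambda>b p. H b (p - 1)) B) \<subseteq> M"
  proof (rule solvable_imp_mem)
    show "solvable (fact N) (length (map (\<lambda>b p. H b (p - 1)) B)) ?rows"
      using assms(2,3) by (simp add: certifies_def Let_def)
    fix v assume "v \<in> set ?rows"
    then obtain r where r: "r \<in> set R" "v = map (\<lambda>b. coordinate w b (terms (Suc m) r)) B" by auto
    have wf: "well_formed w r" using assms(2) r(1) by (auto simp: certifies_def Let_def list_all_iff)
    have "combine v (map (\<lambda>b p. H b (p - 1)) B) \<in> M"
      unfolding r(2)
    proof (rule coordinates_mem[OF B _ assms(1)])
      show "terms_value (terms (Suc m) r) \<in> M" using wf assms(4) by (intro terms_mem) auto
      show "\<forall>(a, s)\<in>set (terms (Suc m) r). 0 \<notin> set s \<and> sum_list s = w \<and>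
          (length s < m \<or> s \<in> set B \<or> rev s \<in> set B)"
      proof (clarify, intro conjI)
        fix a s assume s: "(a, s) \<in> set (terms (Suc m) r)"
        then have "length s \<le> m" using len r(1) by blast
        then show "length s < m \<or> s \<in> set B \<or> rev s \<in> set B"
          using cov[of s] terms_pos[OF wf s] by linarith
      qed (use terms_pos[OF wf] in blast)+
    qed
    then show "length v = length (map (\<lambda>b p. H b (p - 1)) B) \<and> combine v (map (\<lambda>b p. H b (p - 1)) B) \<in> M"
      using r by simp
  qed (use N in auto)
  then have B_mem: "(\<lambda>p. H b (p - 1)) \<in> M" if "b \<in> set B" for b using that by fastforce
  show ?thesis
    unfolding covered_def
  proof (intro allI impI)
    fix s assume s: "0 \<notin> set s \<and> sum_list s = w \<and> length s \<le> m"
    show "(\<lambda>p. H s (p - 1)) \<in> M"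
    proof (cases "length s = m")
      case True
      then have "s \<in> set B \<or> rev s \<in> set B" using s cov by blast
      then show ?thesis
      proof
        assume "rev s \<in> set B"
        from cong_span_add[OF reversal_mem sign_scale[OF B_mem[OF this]], of s "sum_list s"]
        show ?thesis using s by simp
      qed (rule B_mem)
    qed (use s coveredD[OF assms(1), of s] in auto)
  qed
qed

end

section \<open>Sums of weight at most four\<close>

text \<open>Hence \<open>w < p - 1\<close>, the bound used in depth one and two, for all weights up to 9.\<close>

lemma prime_gt_7_imp_ge_11:
  assumes "prime p" "p > (7 :: nat)"
  shows "p \<ge> 11"
proof (rule ccontr)
  assume "\<not> p \<ge> 11"
  then consider "p = 8" | "p = 9" | "p = 10" using assms(2) by linarith
  then have "2 dvd p \<or> 3 dvd p" by cases auto
  then show False using assms by (auto simp: prime_nat_iff)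
qed

context weight_module
begin

lemma covered_1:
  assumes "0 < w" "w \<le> 9"
  shows "covered 1"
  unfolding covered_def
proof (intro allI impI)
  fix s assume s: "0 \<notin> set s \<and> sum_list s = w \<and> length s \<le> 1"
  then have "s = [w]" using assms by (cases s) auto
  moreover have "(\<lambda>p. H [w] (p - 1)) \<in> M"
  proof (rule cong_span_cong[OF cong_span_0])
    fix p :: nat assume "prime p" "p > 7"
    then show "rat_cong (H [w] (p - 1)) 0 p"
      using assms prime_gt_7_imp_ge_11[of p] by (intro H_depth_1) auto
  qed
  ultimately show "(\<lambda>p. H s (p - 1)) \<in> M" by simp
qed

lemma covered_2:
  assumes "0 < w" "w \<le> 9" "(\<lambda>p. bernoulli (p - w)) \<in> M"
    "\<And>b. b \<in> {1..<w} \<Longrightarrow> of_nat ((w - 1) choose (b - 1)) / of_nat b \<in> Q_smooth N"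
  shows "covered 2"
  unfolding covered_def
proof (intro allI impI)
  fix s assume s: "0 \<notin> set s \<and> sum_list s = w \<and> length s \<le> 2"
  show "(\<lambda>p. H s (p - 1)) \<in> M"
  proof (cases "length s = 2")
    case False
    show ?thesis by (rule coveredD[OF covered_1[OF assms(1,2)]]) (use s False in auto)
  next
    case True
    then obtain b a where ba: "s = [b, a]" by (auto simp: numeral_2_eq_2 length_Suc_conv)
    then have pos: "0 < a" "0 < b" "a + b = w" using s by auto
    have "(\<lambda>p. of_nat ((w - 1) choose (b - 1)) / of_nat b * bernoulli (p - w)) \<in> M"
      using assms pos N by (intro cong_span_scale) auto
    from sign_scale[OF this, of b] have "(\<lambda>p. H [b, a] (p - 1)) \<in> M"
    proof (rule cong_span_cong)
      fix p :: nat assume "prime p" "p > 7"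
      then show "rat_cong (H [b, a] (p - 1))
          ((-1) ^ b * (of_nat ((w - 1) choose (b - 1)) / of_nat b * bernoulli (p - w))) p"
        using H_depth_2[of p a b] pos assms(2) prime_gt_7_imp_ge_11[of p]
        by (simp add: mult.assoc)
    qed
    then show ?thesis using ba by simp
  qed
qed

end

text \<open>Weights in which all sums are congruent to \<open>0\<close>. A product with a factor of such a weight lies in every
  module.\<close>

definition vanishing :: "nat \<Rightarrow> bool" where
  "vanishing w \<longleftrightarrow> (\<forall>s p. 0 \<notin> set s \<and> sum_list s = w \<and> prime p \<and> p > 7 \<longrightarrow>
     rat_cong (H s (p - 1)) 0 p)"

lemma product_vanishing:
  assumes "vanishing (sum_list u) \<or> vanishing (sum_list v)" "0 \<notin> set u" "0 \<notin> set v"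
  shows "(\<lambda>p. H u (p - 1) * H v (p - 1)) \<in> cong_span N g h"
proof (rule cong_span_cong[OF cong_span_0])
  fix p :: nat assume p: "prime p" "p > 7"
  have int: "p_integral p (H s (p - 1))" for s using p by (intro p_integral_H) auto
  show "rat_cong (H u (p - 1) * H v (p - 1)) 0 p"
    using assms(1)
  proof
    assume "vanishing (sum_list u)"
    then have "rat_cong (H u (p - 1)) 0 p" using p assms(2) by (auto simp: vanishing_def)
    from rat_cong_mult_right[OF p(1) int this] show ?thesis by simp
  next
    assume "vanishing (sum_list v)"
    then have "rat_cong (H v (p - 1)) 0 p" using p assms(3) by (auto simp: vanishing_def)
    from rat_cong_mult_left[OF p(1) int this] show ?thesis by simp
  qed
qed

lemma sum_list_pos_nat: "s \<noteq> [] \<Longrightarrow> 0 \<notin> set s \<Longrightarrow> 0 < sum_list (s :: nat list)"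
  by (cases s) auto

lemma weight_moduleI:
  assumes N: "2 \<le> N" "N \<le> 7"
    and split: "\<And>i. i \<in> {1..<w} \<Longrightarrow> vanishing i \<or> vanishing (w - i) \<or>
      (\<forall>u v. 0 \<notin> set u \<and> 0 \<notin> set v \<and> sum_list u = i \<and> sum_list v = w - i \<longrightarrow>
        (\<lambda>p. H u (p - 1) * H v (p - 1)) \<in> cong_span N g h)"
  shows "weight_module N w g h"
proof
  fix u v :: "nat list"
  assume uv: "u \<noteq> []" "v \<noteq> []" "0 \<notin> set u" "0 \<notin> set v" "sum_list u + sum_list v = w"
  then have "sum_list u \<in> {1..<w}" "sum_list v = w - sum_list u"
    using sum_list_pos_nat[of u] sum_list_pos_nat[of v] by auto
  from split[OF this(1)] this(2) uv show "(\<lambda>p. H u (p - 1) * H v (p - 1)) \<in> cong_span N g h"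
    using product_vanishing[of u v N g h] by metis
qed (use N in auto)

lemma weight_module_vanishing:
  assumes "2 \<le> N" "N \<le> 7" "\<And>i. i \<in> {1..<w} \<Longrightarrow> vanishing i \<or> vanishing (w - i)"
  shows "weight_module N w g h"
  using assms by (intro weight_moduleI) blast+

lemma vanishingI:
  assumes "\<And>s. 0 \<notin> set s \<Longrightarrow> sum_list s = w \<Longrightarrow>
    (\<lambda>p. H s (p - 1)) \<in> cong_span 2 (\<lambda>p. 0) (\<lambda>p. 0)"
  shows "vanishing w"
  unfolding vanishing_def
proof (intro allI impI)
  fix s and p :: nat assume s: "0 \<notin> set s \<and> sum_list s = w \<and> prime p \<and> 7 < p"
  from assms[of s] s have "(\<lambda>p. H s (p - 1)) \<in> cong_span 2 (\<lambda>p. 0) (\<lambda>p. 0)" by blast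
  then show "rat_cong (H s (p - 1)) 0 p" by (rule cong_spanE) (use s in auto)
qed

lemma vanishing_1: "vanishing 1"
proof (rule vanishingI)
  interpret weight_module 2 1 "\<lambda>p. 0" "\<lambda>p. 0" by (rule weight_module_vanishing) auto
  fix s :: "nat list" assume "0 \<notin> set s" "sum_list s = 1"
  then show "(\<lambda>p. H s (p - 1)) \<in> M"
    using covered_duality(1)[OF covered_1] by simp
qed

lemma vanishing_2: "vanishing 2"
proof (rule vanishingI)
  interpret weight_module 2 2 "\<lambda>p. 0" "\<lambda>p. 0"
  proof (rule weight_module_vanishing)
    fix i :: nat assume "i \<in> {1..<2}"
    then have "i = 1" by auto
    then show "vanishing i \<or> vanishing (2 - i)" using vanishing_1 by simp
  qed auto
  fix s :: "nat list" assume "0 \<notin> set s" "sum_list s = 2"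
  then show "(\<lambda>p. H s (p - 1)) \<in> M"
    using covered_duality(1)[OF covered_1] by simp
qed

lemma vanishing_4: "vanishing 4"
proof (rule vanishingI)
  interpret weight_module 2 4 "\<lambda>p. 0" "\<lambda>p. 0"
  proof (rule weight_module_vanishing)
    fix i :: nat assume "i \<in> {1..<4}"
    then have "i = 1 \<or> i = 2 \<or> i = 3" by auto
    then show "vanishing i \<or> vanishing (4 - i)"
      using vanishing_1 vanishing_2 by auto
  qed auto
  have "covered (Suc 1)" by (rule covered_Suc_parity[OF covered_1]) auto
  then show "(\<lambda>p. H s (p - 1)) \<in> M" if "0 \<notin> set s" "sum_list s = 4" for s
    using covered_duality(1) that by simp
qed

lemma Q_smoothI:
  assumes "x * of_nat b = of_int a" "b dvd fact N ^ 60"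
  shows "x \<in> Q_smooth N"
proof -
  have "int b dvd int (fact N ^ 60)" using assms(2) by (simp only: int_dvd_int_iff)
  then have "smooth N (int b)" by (intro smooth_dvd_fact_power[of _ _ 60]) simp
  moreover from this have "b \<noteq> 0" by (auto simp: smooth_def)
  then have "x = of_int a / of_int (int b)" using assms(1) by (simp add: field_simps)
  ultimately show ?thesis unfolding Q_smooth_iff by blast
qed

lemma cong_span_generators:
  "g \<in> cong_span N g h" "h \<in> cong_span N g h"
  by (rule cong_spanI[of 1 _ 0], auto) (rule cong_spanI[of 0 _ 1], auto)

lemma weight_3:
  assumes "0 \<notin> set s" "sum_list s = 3"
  shows "(\<lambda>p. H s (p - 1)) \<in> cong_span 3 (\<lambda>p. bernoulli (p - 3)) (\<lambda>p. 0)"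
proof -
  interpret weight_module 3 3 "\<lambda>p. bernoulli (p - 3)" "\<lambda>p. 0"
  proof (rule weight_module_vanishing)
    fix i :: nat assume "i \<in> {1..<3}"
    then have "i = 1 \<or> i = 2" by auto
    then show "vanishing i \<or> vanishing (3 - i)"
      using vanishing_1 vanishing_2 by auto
  qed auto
  have "covered 2"
  proof (rule covered_2[OF _ _ cong_span_generators(1)])
    fix b :: nat assume "b \<in> {1..<3}"
    then have "b = 1 \<or> b = 2" by auto
    then show "of_nat ((3 - 1) choose (b - 1)) / of_nat b \<in> Q_smooth 3"
      using Q_smooth_1 by auto
  qed auto
  then show ?thesis using covered_duality(1) assms by simp
qed

section \<open>Sums of weight six, seven and nine\<close>

lemma cong_span_mult:
  assumes "f \<in> cong_span N g (\<lambda>p. 0)" "f' \<in> cong_span N g' (\<lambda>p. 0)" "N \<le> 7"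
    and int: "\<And>p. prime p \<Longrightarrow> p > 7 \<Longrightarrow> p_integral p (f p)"
      "\<And>p. prime p \<Longrightarrow> p > 7 \<Longrightarrow> p_integral p (g' p)"
  shows "(\<lambda>p. f p * f' p) \<in> cong_span N (\<lambda>p. g p * g' p) h"
proof -
  obtain \<alpha> \<beta> where 1: "\<alpha> \<in> Q_smooth N" "\<beta> \<in> Q_smooth N"
    "\<And>p. prime p \<Longrightarrow> p > 7 \<Longrightarrow> rat_cong (f p) (\<alpha> * g p + \<beta> * 0) p"
    using assms(1) by (rule cong_spanE) blast
  obtain \<alpha>' \<beta>' where 2: "\<alpha>' \<in> Q_smooth N" "\<beta>' \<in> Q_smooth N"
    "\<And>p. prime p \<Longrightarrow> p > 7 \<Longrightarrow> rat_cong (f' p) (\<alpha>' * g' p + \<beta>' * 0) p"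
    using assms(2) by (rule cong_spanE) blast
  show ?thesis
  proof (rule cong_spanI[of "\<alpha> * \<alpha>'" _ 0])
    fix p :: nat assume p: "prime p" "p > 7"
    have "p_integral p \<alpha>'" using p 2(1) assms(3) by (intro p_integral_Q_smooth[of p N]) auto
    then have "rat_cong (f p * f' p) (\<alpha> * g p * (\<alpha>' * g' p)) p"
      using 1(3) 2(3) int p by (intro rat_cong_mult) auto
    then show "rat_cong (f p * f' p) (\<alpha> * \<alpha>' * (g p * g' p) + 0 * h p) p"
      by (simp add: mult_ac)
  qed (use 1 2 Q_smooth_mult in auto)
qed

lemma p_integral_bernoulli_3: "prime p \<Longrightarrow> p > 7 \<Longrightarrow> p_integral p (bernoulli (p - 3))"
  by (rule p_integral_bernoulli) auto

text \<open>The relations are listed in the order of elimination: after the preceding steps, the relation at each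
  position has a pivot with no prime factors other than 2 and 3 (in weight 7, other than 2) at the list of
  exponents in the same position.\<close>

lemma certificate_6: "certifies 6 6 3
  [[2, 1, 3], [2, 2, 2], [1, 2, 3], [1, 4, 1], [1, 3, 2], [1, 1, 4]]
  [Stuffle [1] [2, 3], Shuffle [2] [1, 3], Shuffle [1] [1, 4], Stuffle [1] [1, 4],
   Reduced_Shuffle [1] [1, 3, 1], Stuffle [2] [2, 2]]"
  by code_simp

lemma certificate_7: "certifies 7 2 4
  [[1, 1, 4, 1], [2, 1, 2, 2], [1, 1, 3, 2], [1, 2, 3, 1], [1, 1, 2, 3], [1, 2, 1, 3], [1,
   1, 1, 4], [2, 1, 1, 3], [1, 3, 1, 2], [1, 2, 2, 2]]
  [Stuffle [1] [1, 1, 4], Stuffle [2] [1, 2, 2], Shuffle [1] [1, 1, 4], Stuffle [1] [1, 2,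
   3], Shuffle [1] [1, 2, 3], Stuffle [1] [1, 3, 2], Shuffle [1] [1, 3, 2], Stuffle [1] [2,
   1, 3], Shuffle [1] [2, 1, 3], Shuffle [2] [1, 1, 3]]"
  by code_simp

lemma certificate_9: "certifies 9 6 4
  [[3, 1, 2, 3], [2, 2, 3, 2], [1, 1, 6, 1], [2, 1, 4, 2], [2, 3, 1, 3], [1, 4, 1, 3], [1,
   2, 1, 5], [1, 2, 4, 2], [1, 3, 4, 1], [2, 2, 1, 4], [1, 2, 5, 1], [2, 1, 3, 3], [1, 2, 3,
   3], [3, 1, 1, 4], [1, 1, 4, 3], [1, 1, 3, 4], [1, 4, 2, 2], [1, 5, 1, 2], [1, 3, 3, 2],
   [1, 1, 2, 5], [2, 1, 2, 4], [2, 2, 2, 3], [1, 1, 5, 2], [1, 3, 1, 4], [1, 3, 2, 3], [1, 2,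
   2, 4], [1, 1, 1, 6], [2, 1, 1, 5]]
  [Stuffle [3] [1, 2, 3], Stuffle [2] [2, 2, 3], Stuffle [1] [1, 1, 6], Stuffle [2] [1, 4,
   2], Stuffle [1] [2, 3, 3], Stuffle [1] [3, 1, 4], Stuffle [1] [1, 2, 5], Stuffle [2] [1,
   2, 4], Stuffle [1] [1, 3, 4], Stuffle [1] [2, 2, 4], Stuffle [1] [1, 5, 2], Stuffle [2]
   [1, 3, 3], Shuffle [1] [1, 2, 5], Shuffle [1] [3, 1, 4], Shuffle [1] [1, 1, 6], Shuffle
   [1] [1, 3, 4], Shuffle [1] [1, 5, 2], Reduced_Shuffle [1] [1, 1, 5, 1], Shuffle [1] [2, 1,
   5], Reduced_Shuffle [1] [1, 1, 1, 5], Shuffle [2] [1, 1, 5], Shuffle [1] [2, 2, 4],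
   Stuffle [1] [2, 1, 5], Stuffle [1] [1, 4, 3], Shuffle [1] [1, 4, 3], Shuffle [2] [1, 3,
   3], Shuffle [2] [1, 2, 4], Reduced_Shuffle [1] [1, 1, 2, 4]]"
  by code_simp

text \<open>Depth 2 comes from the antipode, depth 3 from the certificate, and duality exchanges depths \<open>r\<close> and
  \<open>7 - r\<close>. Among the products only those of two sums of weight 3 can be nonzero.\<close>

lemma weight_6:
  assumes "0 \<notin> set s" "sum_list s = 6"
  shows "(\<lambda>p. H s (p - 1)) \<in> cong_span 3 (\<lambda>p. bernoulli (p - 3) * bernoulli (p - 3)) (\<lambda>p. 0)"
proof -
  interpret weight_module 3 6 "\<lambda>p. bernoulli (p - 3) * bernoulli (p - 3)" "\<lambda>p. 0"
  proof (rule weight_moduleI)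
    fix i :: nat assume "i \<in> {1..<6}"
    then consider "i = 1 \<or> i = 2 \<or> i = 4 \<or> i = 5" | "i = 3" by fastforce
    then show "vanishing i \<or> vanishing (6 - i) \<or>
      (\<forall>u v. 0 \<notin> set u \<and> 0 \<notin> set v \<and> sum_list u = i \<and> sum_list v = 6 - i \<longrightarrow>
        (\<lambda>p. H u (p - 1) * H v (p - 1)) \<in>
          cong_span 3 (\<lambda>p. bernoulli (p - 3) * bernoulli (p - 3)) (\<lambda>p. 0))"
    proof cases
      case 1
      then show ?thesis using vanishing_1 vanishing_2 vanishing_4 by auto
    next
      case 2
      then show ?thesis
        using weight_3 p_integral_bernoulli_3
        by (auto intro!: cong_span_mult p_integral_H simp del: One_nat_def)
    qed
  qed auto
  have "covered (Suc 1)" by (rule covered_Suc_parity[OF covered_1]) auto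
  then have "covered (3 - 1)" by (simp add: numeral_2_eq_2)
  then have "covered 3"
    by (rule covered_by_certificate[OF _ certificate_6]) (auto simp: fact_numeral)
  then show ?thesis using covered_duality(1) assms by simp
qed

text \<open>In each product of total weight 7 one factor has weight 1, 2 or 4 and vanishes. The constants in depth 2
  are integers, and depths 3 and 4 introduce denominators that are powers of 2.\<close>

lemma weight_7:
  assumes "0 \<notin> set s" "sum_list s = 7"
  shows "(\<lambda>p. H s (p - 1)) \<in> cong_span 2 (\<lambda>p. bernoulli (p - 7)) (\<lambda>p. 0)"
    and "(\<lambda>p. S s (p - 1)) \<in> cong_span 2 (\<lambda>p. bernoulli (p - 7)) (\<lambda>p. 0)"
proof -
  interpret weight_module 2 7 "\<lambda>p. bernoulli (p - 7)" "\<lambda>p. 0"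
  proof (rule weight_module_vanishing)
    fix i :: nat assume "i \<in> {1..<7}"
    then have "i = 1 \<or> i = 2 \<or> i = 3 \<or> i = 4 \<or> i = 5 \<or> i = 6" by fastforce
    then show "vanishing i \<or> vanishing (7 - i)"
      using vanishing_1 vanishing_2 vanishing_4 by auto
  qed auto
  have "covered 2"
  proof (rule covered_2[OF _ _ cong_span_generators(1)])
    fix b :: nat assume "b \<in> {1..<7}"
    moreover have "\<forall>b\<in>{1..<7}. b dvd (6 choose (b - 1))" by code_simp
    ultimately have "b dvd (6 choose (b - 1))" by blast
    then obtain c where "6 choose (b - 1) = b * c" by blast
    then show "of_nat ((7 - 1) choose (b - 1)) / of_nat b \<in> Q_smooth 2"
      using Q_smooth_of_int[of "int c" 2] \<open>b \<in> {1..<7}\<close> by simp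
  qed auto
  then have "covered (Suc 2)" by (rule covered_Suc_parity) auto
  then have "covered (4 - 1)" by simp
  then have "covered 4"
    by (rule covered_by_certificate[OF _ certificate_7]) (auto simp: fact_numeral)
  then show "(\<lambda>p. H s (p - 1)) \<in> M" "(\<lambda>p. S s (p - 1)) \<in> M"
    using covered_duality[of 4] assms by simp_all
qed

text \<open>A product of total weight 9 vanishes unless its factors have weights 3 and 6, and then it is a multiple
  of \<open>B\<^sub>p\<^sub>-\<^sub>3\<^sup>3\<close>. The constants in depth 2 are \<open>\<plusminus>(8 choose b - 1)/b\<close>, whose denominators divide 3. Depths 3
  and 5 come from the antipode, depth 4 from the certificate, and the others by duality.\<close>

lemma weight_9:
  assumes "0 \<notin> set s" "sum_list s = 9"
  shows "(\<lambda>p. H s (p - 1)) \<in> cong_span 3 (\<lambda>p. bernoulli (p - 9)) (\<lambda>p. bernoulli (p - 3) ^ 3)"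
    and "(\<lambda>p. S s (p - 1)) \<in> cong_span 3 (\<lambda>p. bernoulli (p - 9)) (\<lambda>p. bernoulli (p - 3) ^ 3)"
proof -
  let ?M = "cong_span 3 (\<lambda>p. bernoulli (p - 9)) (\<lambda>p. bernoulli (p - 3) ^ 3)"
  have prod: "(\<lambda>p. H u (p - 1) * H v (p - 1)) \<in> ?M"
    if uv: "0 \<notin> set u" "0 \<notin> set v" "sum_list u = 3" "sum_list v = 6" for u v
  proof -
    have "(\<lambda>p. H u (p - 1) * H v (p - 1)) \<in>
      cong_span 3 (\<lambda>p. bernoulli (p - 3) * (bernoulli (p - 3) * bernoulli (p - 3))) (\<lambda>p. 0)"
      using uv weight_3 weight_6 p_integral_bernoulli_3
      by (intro cong_span_mult) (auto intro!: p_integral_H)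
    then obtain \<alpha> \<beta> where "\<alpha> \<in> Q_smooth 3" "\<beta> \<in> Q_smooth 3"
      "\<And>p. prime p \<Longrightarrow> p > 7 \<Longrightarrow> rat_cong (H u (p - 1) * H v (p - 1))
         (\<alpha> * (bernoulli (p - 3) * (bernoulli (p - 3) * bernoulli (p - 3))) + \<beta> * 0) p"
      by (rule cong_spanE) blast
    then show ?thesis by (intro cong_spanI[of 0 _ \<alpha>]) (auto simp: power3_eq_cube mult_ac)
  qed
  interpret weight_module 3 9 "\<lambda>p. bernoulli (p - 9)" "\<lambda>p. bernoulli (p - 3) ^ 3"
  proof (rule weight_moduleI)
    fix i :: nat assume "i \<in> {1..<9}"
    then consider "i = 1 \<or> i = 2 \<or> i = 4 \<or> i = 5 \<or> i = 7 \<or> i = 8" | "i = 3" | "i = 6" by fastforce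
    then show "vanishing i \<or> vanishing (9 - i) \<or>
      (\<forall>u v. 0 \<notin> set u \<and> 0 \<notin> set v \<and> sum_list u = i \<and> sum_list v = 9 - i \<longrightarrow>
        (\<lambda>p. H u (p - 1) * H v (p - 1)) \<in> ?M)"
    proof cases
      case 1
      then show ?thesis using vanishing_1 vanishing_2 vanishing_4 by auto
    next
      case 2
      then show ?thesis using prod by auto
    next
      case 3
      have "(\<lambda>p. H u (p - 1) * H v (p - 1)) \<in> ?M"
        if "0 \<notin> set u" "0 \<notin> set v" "sum_list u = 6" "sum_list v = 3" for u v
        using prod[of v u] that by (simp add: mult.commute)
      then show ?thesis using 3 by auto
    qed
  qed auto
  have "covered 2"
  proof (rule covered_2[OF _ _ cong_span_generators(1)])
    fix b :: nat assume b: "b \<in> {1..<9}"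
    moreover have "\<forall>b\<in>{1..<9}. b dvd 3 * (8 choose (b - 1))" by code_simp
    ultimately have "b dvd 3 * (8 choose (b - 1))" by blast
    then obtain c where "3 * (8 choose (b - 1)) = b * c" by blast
    then have "of_nat (3 * (8 choose (b - 1))) = (of_nat (b * c) :: rat)" by (rule arg_cong)
    then have "of_nat ((9 - 1) choose (b - 1)) / of_nat b * of_nat 3 = (of_int (int c) :: rat)"
      using b by (simp add: field_simps)
    then show "of_nat ((9 - 1) choose (b - 1)) / of_nat b \<in> Q_smooth 3"
      by (rule Q_smoothI) (simp add: fact_numeral)
  qed auto
  then have "covered (Suc 2)" by (rule covered_Suc_parity) auto
  then have "covered (4 - 1)" by simp
  then have "covered 4"
    by (rule covered_by_certificate[OF _ certificate_9]) (auto simp: fact_numeral)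
  then have "covered (Suc 4)" by (rule covered_Suc_parity) auto
  then show "(\<lambda>p. H s (p - 1)) \<in> M" "(\<lambda>p. S s (p - 1)) \<in> M"
    using covered_duality[of 5] assms by simp_all
qed

theorem corollary4p2:
  shows "(\<forall>s :: nat list. (\<forall>a\<in>set s. a > 0) \<and> sum_list s = 7 \<longrightarrow>
           (\<exists>\<alpha>\<in>Q_smooth 2. \<exists>\<alpha>'\<in>Q_smooth 2. \<forall>p::nat. prime p \<and> p > 7 \<longrightarrow>
              rat_cong (mhs_star (p - 1) s) (\<alpha> * bernoulli (p - 7)) p \<and>
              rat_cong (mhs (p - 1) s) (\<alpha>' * bernoulli (p - 7)) p))
       \<and> (\<forall>s :: nat list. (\<forall>a\<in>set s. a > 0) \<and> sum_list s = 9 \<longrightarrow>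
           (\<exists>\<alpha>\<in>Q_smooth 3. \<exists>\<beta>\<in>Q_smooth 3. \<exists>\<alpha>'\<in>Q_smooth 3. \<exists>\<beta>'\<in>Q_smooth 3.
            \<forall>p::nat. prime p \<and> p > 7 \<longrightarrow>
              rat_cong (mhs_star (p - 1) s)
                (\<alpha> * bernoulli (p - 9) + \<beta> * bernoulli (p - 3) ^ 3) p \<and>
              rat_cong (mhs (p - 1) s)
                (\<alpha>' * bernoulli (p - 9) + \<beta>' * bernoulli (p - 3) ^ 3) p))"
proof (intro conjI allI impI)
  fix s :: "nat list" assume "(\<forall>a\<in>set s. a > 0) \<and> sum_list s = 7"
  then have s: "0 \<notin> set (rev s)" "sum_list (rev s) = 7" by auto
  obtain \<alpha> \<beta> where 1: "\<alpha> \<in> Q_smooth 2"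
    "\<And>p. prime p \<Longrightarrow> p > 7 \<Longrightarrow> rat_cong (S (rev s) (p - 1)) (\<alpha> * bernoulli (p - 7) + \<beta> * 0) p"
    using weight_7(2)[OF s] by (rule cong_spanE) blast
  obtain \<alpha>' \<beta>' where 2: "\<alpha>' \<in> Q_smooth 2"
    "\<And>p. prime p \<Longrightarrow> p > 7 \<Longrightarrow> rat_cong (H (rev s) (p - 1)) (\<alpha>' * bernoulli (p - 7) + \<beta>' * 0) p"
    using weight_7(1)[OF s] by (rule cong_spanE) blast
  show "\<exists>\<alpha>\<in>Q_smooth 2. \<exists>\<alpha>'\<in>Q_smooth 2. \<forall>p::nat. prime p \<and> p > 7 \<longrightarrow>
      rat_cong (mhs_star (p - 1) s) (\<alpha> * bernoulli (p - 7)) p \<and>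
      rat_cong (mhs (p - 1) s) (\<alpha>' * bernoulli (p - 7)) p"
    using 1 2 by (intro bexI[of _ \<alpha>] bexI[of _ \<alpha>']) (auto simp: mhs_eq_H mhs_star_eq_S)
next
  fix s :: "nat list" assume "(\<forall>a\<in>set s. a > 0) \<and> sum_list s = 9"
  then have s: "0 \<notin> set (rev s)" "sum_list (rev s) = 9" by auto
  obtain \<alpha> \<beta> where 1: "\<alpha> \<in> Q_smooth 3" "\<beta> \<in> Q_smooth 3"
    "\<And>p. prime p \<Longrightarrow> p > 7 \<Longrightarrow>
       rat_cong (S (rev s) (p - 1)) (\<alpha> * bernoulli (p - 9) + \<beta> * bernoulli (p - 3) ^ 3) p"
    using weight_9(2)[OF s] by (rule cong_spanE) blast
  obtain \<alpha>' \<beta>' where 2: "\<alpha>' \<in> Q_smooth 3" "\<beta>' \<in> Q_smooth 3"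
    "\<And>p. prime p \<Longrightarrow> p > 7 \<Longrightarrow>
       rat_cong (H (rev s) (p - 1)) (\<alpha>' * bernoulli (p - 9) + \<beta>' * bernoulli (p - 3) ^ 3) p"
    using weight_9(1)[OF s] by (rule cong_spanE) blast
  show "\<exists>\<alpha>\<in>Q_smooth 3. \<exists>\<beta>\<in>Q_smooth 3. \<exists>\<alpha>'\<in>Q_smooth 3. \<exists>\<beta>'\<in>Q_smooth 3.
      \<forall>p::nat. prime p \<and> p > 7 \<longrightarrow>
        rat_cong (mhs_star (p - 1) s)
          (\<alpha> * bernoulli (p - 9) + \<beta> * bernoulli (p - 3) ^ 3) p \<and>
        rat_cong (mhs (p - 1) s)
          (\<alpha>' * bernoulli (p - 9) + \<beta>' * bernoulli (p - 3) ^ 3) p"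
    using 1 2
    by (intro bexI[of _ \<alpha>] bexI[of _ \<beta>] bexI[of _ \<alpha>'] bexI[of _ \<beta>'])
       (auto simp: mhs_eq_H mhs_star_eq_S)
qed

end
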